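(* Let $(M,\nu,\mathfrak{e})$, $(\mathscr{O},\eta,e)$, $\tau$ form a $c$-monop, and let $P_{(M,\mathscr O)}[n]$ denote the associated poset on $(M\cdot E(\mathscr O))[\{1,\dots,n\}]$. Define, for $0\leq k\leq n$, $C_{n,k}=|M\cdot\gamma_k(\mathscr{O})[n]|$ and $\widehat C_{n,k}=|M\cdot\gamma_k(\mathscr{O})[n]|_\mu$. Then the infinite lower triangular matrices $(C_{n,k})$ and $(\widehat C_{n,k})$ are inverse to each other: $\sum_{k=j}^{n}C_{n,k}\widehat C_{k,j}=\delta_{n,j}$ for all $0\le j\le n$. Equivalently, $(C_{n,k})$ is the Riordan array of the Riordan pair $(M(x),\mathscr{O}(x))$ and $(\widehat C_{n,k})$ is the Riordan array of its inverse pair $(M(x),\mathscr{O}(x))^{-1}=\big(1/M(\mathscr O^{\langle-1\rangle}(x)),\mathscr O^{\langle-1\rangle}(x)\big)$.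
   Context: Species are functors from finite sets with bijections to finite sets; positive means $F[\emptyset]=\emptyset$; sums are disjoint unions; $[n]=\{1,\dots,n\}$. Product $(M\cdot N)[V]=\sum_{V_1+V_2=V}M[V_1]\times N[V_2]$. For positive $P$, $R(P)[V]=\sum_\pi(\prod_{B\in\pi}P[B])\times R[\pi]$ over partitions $\pi$ of $V$; elements are pairs $(a,r)$ with $a=\{p_B\}_{B\in\pi}$ an assembly of $P$-structures. $E(P)[V]$ is the set of all assemblies of $P$-structures on $V$; $\gamma_k(P)[V]$ those with exactly $k$ members; $|a|$ is the number of members. $M\cdot\gamma_k(\mathscr O)[n]\subseteq (M\cdot E(\mathscr O))[n]$ is the set of pairs $(m,a)$ with $|a|=k$. For a subset $A$ of a poset with least element $\hat0$, $|A|_\mu=\sum_{x\in A}\mu(\hat0,x)$, $\mu$ the Möbius function. Exponential generating series $F(x)=\sum_n|F[n]|x^n/n!$; for a series $H$, $H[n]$ denotes $n!$ times the coefficient of $x^n$. The Riordan array of a pair $(F,G)$ with $F(0)\neq0$, $G(0)=0$, $G'(0)\ne0$ is the matrix with entries $\big(F(x)\,G(x)^k/k!\big)[n]$; $G^{\langle-1\rangle}$ is the compositional inverse. Monoid $(M,\nu,\mathfrak e)$: $\nu:M\cdot M\to M$ associative with two-sided unit $\mathfrak e\in M[\emptyset]$. Operad $(\mathscr O,\eta,e)$: $\mathscr O$ positive, $\eta:\mathscr O(\mathscr O)\to\mathscr O$, $e_v\in\mathscr O[\{v\}]$; for an assembly $a=\{\omega_C\}_{C\in\pi}$ on $V$ and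 an assembly $b=\{w_D\}_{D\in\sigma}$ on the set $\pi$, $\bar\eta(a,b)=\{\eta(\{\omega_C\}_{C\in D},w_D)\}_{D\in\sigma}$; axioms $\eta(\bar\eta(a,b),\omega)=\eta(a,\eta(b,\omega))$, $\eta(\{e_v\}_{v\in V},\omega)=\omega=\eta(\{\omega\},e_V)$. Right module: $\tau:M(\mathscr O)\to M$ with $\tau(\bar\eta(a,b),m)=\tau(a,\tau(b,m))$ and $\tau(\{e_v\}_{v\in V},m)=m$. Compatibility: $\nu(\tau(a_1,m_1),\tau(a_2,m_2))=\tau(a_1\sqcup a_2,\nu(m_1,m_2))$ for disjoint supports. A $c$-monop is such data with in addition: $|M[\emptyset]|=1$; $\nu(m_1,m_2)=\nu(m_1,m_2')\Rightarrow m_2=m_2'$; $|\mathscr O[\{v\}]|=1$ for every singleton; $\eta(a,\omega)=\eta(a,\omega')\Rightarrow\omega=\omega'$; $\tau(a,m)=\tau(a,m')\Rightarrow m=m'$. Poset $P_{(M,\mathscr O)}[V]$: underlying set $(M\cdot E(\mathscr O))[V]$; for $(m_1,a_1)$ with $a_1$ of underlying partition $\pi$ and $(m_2',a_2')\in M[\pi_1]\times E(\mathscr O)[\pi_2]$, $\pi=\pi_1+\pi_2$, with $a_1^{(i)}$ the subassembly of $a_1$ over $\pi_i$, put $\bar\rho((m_1,a_1),(m_2',a_2'))=(\nu(m_1,\tau(a_1^{(1)},m_2')),\bar\eta(a_1^{(2)},a_2'))$; $(m_1,a_1)\leq(m_2,a_2)$ iff $(m_2,a_2)=\bar\rho((m_1,a_1),(m_2',a_2'))$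 for some such $(m_2',a_2')$. Its least element is $\hat0=(\mathfrak e,\{e_v\}_{v\in V})$. *)

theory Defs
  imports "HOL-Library.FSet" "HOL-Library.Disjoint_Sets"
    "HOL-Computational_Algebra.Formal_Power_Series"
begin

text \<open>
  A structure may have to be placed on a partition of the ground set, i.e. on a set of sets.
  Species are therefore taken over the finite subsets of one universe of labels that contains the
  natural numbers and is closed under forming finite sets.
\<close>

datatype label = Atom nat | Block "label fset"

definition blk :: "label set \<Rightarrow> label" where
  "blk B = Block (Abs_fset B)"

primrec members :: "label \<Rightarrow> label set" where
  "members (Atom n) = {}"
| "members (Block S) = fset S"

lemma members_blk [simp]: "finite B \<Longrightarrow> members (blk B) = B"
  by (simp add: blk_def Abs_fset_inverse)

lemma blk_inject: "finite A \<Longrightarrow> finite B \<Longrightarrow> blk A = blk B \<longleftrightarrow> A = B"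
  by (metis members_blk)

definition flat :: "label set \<Rightarrow> label set" where
  "flat D = \<Union> (members ` D)"

definition segment :: "nat \<Rightarrow> label set" where
  "segment n = Atom ` {1..n}"


section \<open>Species\<close>

text \<open>
  The structure sets on different ground sets need not be disjoint, so transport along
  \<open>\<sigma> : V \<rightarrow> \<sigma> ` V\<close> receives the source \<open>V\<close> as an argument.
\<close>

record 's species =
  structs :: "label set \<Rightarrow> 's set"
  transport :: "(label \<Rightarrow> label) \<Rightarrow> label set \<Rightarrow> 's \<Rightarrow> 's"

definition is_species :: "'s species \<Rightarrow> bool" where
  "is_species F \<longleftrightarrow>
     (\<forall>V. finite V \<longrightarrow> finite (structs F V)) \<and>
     (\<forall>V \<sigma> s. finite V \<longrightarrow> inj_on \<sigma> V \<longrightarrow> s \<in> structs F V \<longrightarrow>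
        transport F \<sigma> V s \<in> structs F (\<sigma> ` V)) \<and>
     (\<forall>V \<sigma> \<sigma>' s. finite V \<longrightarrow> inj_on \<sigma> V \<longrightarrow> (\<forall>v\<in>V. \<sigma> v = \<sigma>' v) \<longrightarrow> s \<in> structs F V \<longrightarrow>
        transport F \<sigma> V s = transport F \<sigma>' V s) \<and>
     (\<forall>V s. finite V \<longrightarrow> s \<in> structs F V \<longrightarrow> transport F id V s = s) \<and>
     (\<forall>V \<sigma> \<sigma>' s. finite V \<longrightarrow> inj_on \<sigma> V \<longrightarrow> inj_on \<sigma>' (\<sigma> ` V) \<longrightarrow> s \<in> structs F V \<longrightarrow>
        transport F \<sigma>' (\<sigma> ` V) (transport F \<sigma> V s) = transport F (\<sigma>' \<circ> \<sigma>) V s)"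

definition positive :: "'s species \<Rightarrow> bool" where
  "positive F \<longleftrightarrow> structs F {} = {}"

definition species_hom :: "'s species \<Rightarrow> 't species \<Rightarrow> (label set \<Rightarrow> 's \<Rightarrow> 't) \<Rightarrow> bool" where
  "species_hom F G f \<longleftrightarrow>
     (\<forall>V. finite V \<longrightarrow> (\<forall>s \<in> structs F V. f V s \<in> structs G V \<and>
        (\<forall>\<sigma>. inj_on \<sigma> V \<longrightarrow> f (\<sigma> ` V) (transport F \<sigma> V s) = transport G \<sigma> V (f V s))))"

definition prod_species ::
    "'m species \<Rightarrow> 'n species \<Rightarrow> ((label set \<times> label set) \<times> ('m \<times> 'n)) species" where
  "prod_species M N =
     \<lparr>structs = (\<lambda>V. {((V1, V2), (m, n)). V1 \<union> V2 = V \<and> V1 \<inter> V2 = {} \<and>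
                        m \<in> structs M V1 \<and> n \<in> structs N V2}),
      transport = (\<lambda>\<sigma> V ((V1, V2), (m, n)).
                     ((\<sigma> ` V1, \<sigma> ` V2), (transport M \<sigma> V1 m, transport N \<sigma> V2 n)))\<rparr>"

text \<open>An assembly \<open>{p\<^sub>B}\<close>, \<open>B \<in> \<pi>\<close>, is the set of the pairs \<open>(B, p\<^sub>B)\<close>.\<close>

type_synonym 's assembly = "(label set \<times> 's) set"

definition assemblies :: "'s species \<Rightarrow> label set \<Rightarrow> 's assembly set" where
  "assemblies P V =
     {a. inj_on fst a \<and> partition_on V (fst ` a) \<and> (\<forall>(B, p) \<in> a. p \<in> structs P B)}"

text \<open>The underlying partition of an assembly, as a set of labels.\<close>

definition blocks :: "'s assembly \<Rightarrow> label set" where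
  "blocks a = (\<lambda>(B, p). blk B) ` a"

definition subassembly :: "'s assembly \<Rightarrow> label set \<Rightarrow> 's assembly" where
  "subassembly a D = {(B, p) \<in> a. blk B \<in> D}"

definition assembly_transport :: "'s species \<Rightarrow> (label \<Rightarrow> label) \<Rightarrow> 's assembly \<Rightarrow> 's assembly" where
  "assembly_transport P \<sigma> a = (\<lambda>(B, p). (\<sigma> ` B, transport P \<sigma> B p)) ` a"

definition assembly_species :: "'s species \<Rightarrow> 's assembly species" where
  "assembly_species P =
     \<lparr>structs = assemblies P, transport = (\<lambda>\<sigma> V a. assembly_transport P \<sigma> a)\<rparr>"

definition comp_species :: "'r species \<Rightarrow> 'p species \<Rightarrow> ('p assembly \<times> 'r) species" where
  "comp_species R P =
     \<lparr>structs = (\<lambda>V. {(a, r). a \<in> assemblies P V \<and> r \<in> structs R (blocks a)}),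
      transport = (\<lambda>\<sigma> V (a, r).
        (assembly_transport P \<sigma> a, transport R (\<lambda>l. blk (\<sigma> ` members l)) (blocks a) r))\<rparr>"


section \<open>Monoids, operads, modules and c-monops\<close>

locale species_monoid =
  fixes M :: "'m species"
    and \<nu> :: "label set \<Rightarrow> label set \<Rightarrow> 'm \<Rightarrow> 'm \<Rightarrow> 'm"
    and \<ee> :: 'm
  assumes species_M: "is_species M"
    and nu_hom: "species_hom (prod_species M M) M (\<lambda>V ((V1, V2), (m1, m2)). \<nu> V1 V2 m1 m2)"
    and nu_assoc: "\<And>V1 V2 V3 m1 m2 m3.
      finite V1 \<Longrightarrow> finite V2 \<Longrightarrow> finite V3 \<Longrightarrow>
      V1 \<inter> V2 = {} \<Longrightarrow> V1 \<inter> V3 = {} \<Longrightarrow> V2 \<inter> V3 = {} \<Longrightarrow>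
      m1 \<in> structs M V1 \<Longrightarrow> m2 \<in> structs M V2 \<Longrightarrow> m3 \<in> structs M V3 \<Longrightarrow>
      \<nu> (V1 \<union> V2) V3 (\<nu> V1 V2 m1 m2) m3 = \<nu> V1 (V2 \<union> V3) m1 (\<nu> V2 V3 m2 m3)"
    and unit_M: "\<ee> \<in> structs M {}"
    and nu_unit_left: "\<And>V m. finite V \<Longrightarrow> m \<in> structs M V \<Longrightarrow> \<nu> {} V \<ee> m = m"
    and nu_unit_right: "\<And>V m. finite V \<Longrightarrow> m \<in> structs M V \<Longrightarrow> \<nu> V {} m \<ee> = m"

text \<open>
  For an assembly \<open>b\<close> on the set of blocks of \<open>a\<close>, a block \<open>D\<close> of \<open>b\<close> is a set of (labels of)
  blocks of \<open>a\<close> and contributes the block \<open>\<Union>D\<close> to the result.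
\<close>

definition eta_bar ::
    "('o assembly \<Rightarrow> 'o \<Rightarrow> 'o) \<Rightarrow> 'o assembly \<Rightarrow> 'o assembly \<Rightarrow> 'o assembly" where
  "eta_bar \<eta> a b = (\<lambda>(D, w). (flat D, \<eta> (subassembly a D) w)) ` b"

definition unit_assembly :: "(label \<Rightarrow> 'o) \<Rightarrow> label set \<Rightarrow> 'o assembly" where
  "unit_assembly e V = (\<lambda>v. ({v}, e v)) ` V"

text \<open>
  In the associativity and unit laws a structure on a partition \<open>\<sigma>\<close> of \<open>\<pi>\<close> is also read as a
  structure on the induced coarser partition \<open>{\<Union>D | D \<in> \<sigma>}\<close> of \<open>V\<close>, and a structure on \<open>V\<close> as one
  on the partition of \<open>V\<close> into singletons. These identifications are the transports along
  \<open>D \<mapsto> \<Union>D\<close> and \<open>v \<mapsto> {v}\<close>.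
\<close>

definition coarsen :: "label \<Rightarrow> label" where
  "coarsen l = blk (flat (members l))"

definition singleton_blk :: "label \<Rightarrow> label" where
  "singleton_blk v = blk {v}"

locale operad =
  fixes \<O> :: "'o species"
    and \<eta> :: "'o assembly \<Rightarrow> 'o \<Rightarrow> 'o"
    and e :: "label \<Rightarrow> 'o"
  assumes species_O: "is_species \<O>"
    and positive_O: "positive \<O>"
    and eta_hom: "species_hom (comp_species \<O> \<O>) \<O> (\<lambda>V (a, w). \<eta> a w)"
    and unit_O: "\<And>v. e v \<in> structs \<O> {v}"
    and unit_O_natural: "\<And>\<sigma> v. transport \<O> \<sigma> {v} (e v) = e (\<sigma> v)"
    and eta_assoc: "\<And>V a b w.
      finite V \<Longrightarrow> a \<in> assemblies \<O> V \<Longrightarrow> b \<in> assemblies \<O> (blocks a) \<Longrightarrow>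
      w \<in> structs \<O> (blocks b) \<Longrightarrow>
      \<eta> (eta_bar \<eta> a b) (transport \<O> coarsen (blocks b) w) = \<eta> a (\<eta> b w)"
    and eta_unit_left: "\<And>V w. finite V \<Longrightarrow> w \<in> structs \<O> V \<Longrightarrow>
      \<eta> (unit_assembly e V) (transport \<O> singleton_blk V w) = w"
    and eta_unit_right: "\<And>V w. finite V \<Longrightarrow> w \<in> structs \<O> V \<Longrightarrow>
      \<eta> {(V, w)} (e (blk V)) = w"

locale right_module = operad \<O> \<eta> e
  for \<O> :: "'o species" and \<eta> :: "'o assembly \<Rightarrow> 'o \<Rightarrow> 'o" and e :: "label \<Rightarrow> 'o" +
  fixes M :: "'m species"
    and \<tau> :: "'o assembly \<Rightarrow> 'm \<Rightarrow> 'm"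
  assumes species_module: "is_species M"
    and tau_hom: "species_hom (comp_species M \<O>) M (\<lambda>V (a, m). \<tau> a m)"
    and tau_assoc: "\<And>V a b m.
      finite V \<Longrightarrow> a \<in> assemblies \<O> V \<Longrightarrow> b \<in> assemblies \<O> (blocks a) \<Longrightarrow>
      m \<in> structs M (blocks b) \<Longrightarrow>
      \<tau> (eta_bar \<eta> a b) (transport M coarsen (blocks b) m) = \<tau> a (\<tau> b m)"
    and tau_unit: "\<And>V m. finite V \<Longrightarrow> m \<in> structs M V \<Longrightarrow>
      \<tau> (unit_assembly e V) (transport M singleton_blk V m) = m"

locale monop = species_monoid M \<nu> \<ee> + right_module \<O> \<eta> e M \<tau>
  for M :: "'m species" and \<nu> :: "label set \<Rightarrow> label set \<Rightarrow> 'm \<Rightarrow> 'm \<Rightarrow> 'm" and \<ee> :: 'm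
    and \<O> :: "'o species" and \<eta> :: "'o assembly \<Rightarrow> 'o \<Rightarrow> 'o" and e :: "label \<Rightarrow> 'o"
    and \<tau> :: "'o assembly \<Rightarrow> 'm \<Rightarrow> 'm" +
  assumes compatible: "\<And>V1 V2 a1 a2 m1 m2.
      finite V1 \<Longrightarrow> finite V2 \<Longrightarrow> V1 \<inter> V2 = {} \<Longrightarrow>
      a1 \<in> assemblies \<O> V1 \<Longrightarrow> a2 \<in> assemblies \<O> V2 \<Longrightarrow>
      m1 \<in> structs M (blocks a1) \<Longrightarrow> m2 \<in> structs M (blocks a2) \<Longrightarrow>
      \<nu> V1 V2 (\<tau> a1 m1) (\<tau> a2 m2) = \<tau> (a1 \<union> a2) (\<nu> (blocks a1) (blocks a2) m1 m2)"

locale c_monop = monop +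
  assumes card_M_empty: "card (structs M {}) = 1"
    and nu_cancel: "\<And>V1 V2 m1 m2 m2'.
      finite V1 \<Longrightarrow> finite V2 \<Longrightarrow> V1 \<inter> V2 = {} \<Longrightarrow>
      m1 \<in> structs M V1 \<Longrightarrow> m2 \<in> structs M V2 \<Longrightarrow> m2' \<in> structs M V2 \<Longrightarrow>
      \<nu> V1 V2 m1 m2 = \<nu> V1 V2 m1 m2' \<Longrightarrow> m2 = m2'"
    and card_O_singleton: "\<And>v. card (structs \<O> {v}) = 1"
    and eta_cancel: "\<And>V a w w'.
      finite V \<Longrightarrow> a \<in> assemblies \<O> V \<Longrightarrow>
      w \<in> structs \<O> (blocks a) \<Longrightarrow> w' \<in> structs \<O> (blocks a) \<Longrightarrow>
      \<eta> a w = \<eta> a w' \<Longrightarrow> w = w'"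
    and tau_cancel: "\<And>V a m m'.
      finite V \<Longrightarrow> a \<in> assemblies \<O> V \<Longrightarrow>
      m \<in> structs M (blocks a) \<Longrightarrow> m' \<in> structs M (blocks a) \<Longrightarrow>
      \<tau> a m = \<tau> a m' \<Longrightarrow> m = m'"


section \<open>Moebius functions\<close>

text \<open>Well-founded recursion along the strict order; meaningful for finite posets.\<close>

definition moebius :: "'a set \<Rightarrow> ('a \<Rightarrow> 'a \<Rightarrow> bool) \<Rightarrow> 'a \<Rightarrow> 'a \<Rightarrow> int" where
  "moebius A le x =
     wfrec {(z, y). z \<in> A \<and> y \<in> A \<and> le z y \<and> z \<noteq> y}
       (\<lambda>f y. if y = x then 1
              else if le x y then - (\<Sum>z | z \<in> A \<and> le x z \<and> le z y \<and> z \<noteq> y. f z)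
              else 0)"

context
  fixes A :: "'a set" and le :: "'a \<Rightarrow> 'a \<Rightarrow> bool"
  assumes finite_poset: "finite A"
    and poset_refl: "\<And>x. x \<in> A \<Longrightarrow> le x x"
    and poset_antisym: "\<And>x y. x \<in> A \<Longrightarrow> y \<in> A \<Longrightarrow> le x y \<Longrightarrow> le y x \<Longrightarrow> x = y"
    and poset_trans: "\<And>x y z. x \<in> A \<Longrightarrow> y \<in> A \<Longrightarrow> z \<in> A \<Longrightarrow> le x y \<Longrightarrow> le y z \<Longrightarrow> le x z"
begin

lemma moebius_wf: "wf {(z, y). z \<in> A \<and> y \<in> A \<and> le z y \<and> z \<noteq> y}"
proof (rule wf_subset[OF wf_measure])
  show "{(z, y). z \<in> A \<and> y \<in> A \<and> le z y \<and> z \<noteq> y} \<subseteq> measure (\<lambda>y. card {z \<in> A. le z y})"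
  proof clarsimp
    fix z y assume h: "z \<in> A" "y \<in> A" "le z y" "z \<noteq> y"
    have "{u \<in> A. le u z} \<subset> {u \<in> A. le u y}"
      using h poset_refl poset_antisym poset_trans by blast
    then show "card {u \<in> A. le u z} < card {u \<in> A. le u y}"
      using finite_poset by (simp add: psubset_card_mono)
  qed
qed

lemma moebius_rec:
  assumes "y \<in> A"
  shows "moebius A le x y =
    (if y = x then 1
     else if le x y then - (\<Sum>z | z \<in> A \<and> le x z \<and> le z y \<and> z \<noteq> y. moebius A le x z)
     else 0)"
  unfolding moebius_def
  by (subst wfrec[OF moebius_wf]) (auto simp: cut_apply assms intro!: sum.cong)

lemma moebius_sum:
  assumes "x \<in> A" "y \<in> A" "le x y"
  shows "(\<Sum>z | z \<in> A \<and> le x z \<and> le z y. moebius A le x z) = (if x = y then 1 else 0)"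
proof -
  have "{z \<in> A. le x z \<and> le z y} = insert y {z \<in> A. le x z \<and> le z y \<and> z \<noteq> y}"
    using assms poset_refl by auto
  then have "(\<Sum>z | z \<in> A \<and> le x z \<and> le z y. moebius A le x z) =
      moebius A le x y + (\<Sum>z | z \<in> A \<and> le x z \<and> le z y \<and> z \<noteq> y. moebius A le x z)"
    using finite_poset by simp
  moreover have "(\<Sum>z | z \<in> A \<and> le x z \<and> le z y \<and> z \<noteq> y. moebius A le x z) = 0" if "x = y"
    by (rule sum.neutral) (use that assms poset_antisym in blast)
  ultimately show ?thesis
    using assms moebius_rec[OF assms(2), of x] by (cases "x = y") simp_all
qed

end

definition mu_card :: "'a set \<Rightarrow> ('a \<Rightarrow> 'a \<Rightarrow> bool) \<Rightarrow> 'a \<Rightarrow> 'a set \<Rightarrow> int" where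
  "mu_card P le z A = (\<Sum>x\<in>A. moebius P le z x)"


section \<open>The poset of a c-monop\<close>

type_synonym ('m, 'o) pelem = "(label set \<times> label set) \<times> ('m \<times> 'o assembly)"

definition monop_carrier :: "'m species \<Rightarrow> 'o species \<Rightarrow> label set \<Rightarrow> ('m, 'o) pelem set" where
  "monop_carrier M \<O> V = structs (prod_species M (assembly_species \<O>)) V"

fun rho_bar ::
    "(label set \<Rightarrow> label set \<Rightarrow> 'm \<Rightarrow> 'm \<Rightarrow> 'm) \<Rightarrow> ('o assembly \<Rightarrow> 'o \<Rightarrow> 'o) \<Rightarrow>
     ('o assembly \<Rightarrow> 'm \<Rightarrow> 'm) \<Rightarrow> ('m, 'o) pelem \<Rightarrow> ('m, 'o) pelem \<Rightarrow> ('m, 'o) pelem" where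
  "rho_bar \<nu> \<eta> \<tau> ((V1, V2), (m1, a1)) ((\<pi>1, \<pi>2), (m2, a2)) =
     ((V1 \<union> flat \<pi>1, flat \<pi>2),
      (\<nu> V1 (flat \<pi>1) m1 (\<tau> (subassembly a1 \<pi>1) m2), eta_bar \<eta> (subassembly a1 \<pi>2) a2))"

definition monop_le ::
    "'m species \<Rightarrow> (label set \<Rightarrow> label set \<Rightarrow> 'm \<Rightarrow> 'm \<Rightarrow> 'm) \<Rightarrow>
     'o species \<Rightarrow> ('o assembly \<Rightarrow> 'o \<Rightarrow> 'o) \<Rightarrow> ('o assembly \<Rightarrow> 'm \<Rightarrow> 'm) \<Rightarrow>
     ('m, 'o) pelem \<Rightarrow> ('m, 'o) pelem \<Rightarrow> bool" where
  "monop_le M \<nu> \<O> \<eta> \<tau> x y \<longleftrightarrow>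
     (\<exists>z \<in> monop_carrier M \<O> (blocks (snd (snd x))). y = rho_bar \<nu> \<eta> \<tau> x z)"

definition monop_bot :: "'m \<Rightarrow> (label \<Rightarrow> 'o) \<Rightarrow> label set \<Rightarrow> ('m, 'o) pelem" where
  "monop_bot \<ee> e V = (({}, V), (\<ee>, unit_assembly e V))"

definition monop_level :: "'m species \<Rightarrow> 'o species \<Rightarrow> nat \<Rightarrow> label set \<Rightarrow> ('m, 'o) pelem set" where
  "monop_level M \<O> k V = {(s, (m, a)) \<in> monop_carrier M \<O> V. card a = k}"

definition monop_C :: "'m species \<Rightarrow> 'o species \<Rightarrow> nat \<Rightarrow> nat \<Rightarrow> nat" where
  "monop_C M \<O> n k = card (monop_level M \<O> k (segment n))"

definition monop_C_mu ::
    "'m species \<Rightarrow> (label set \<Rightarrow> label set \<Rightarrow> 'm \<Rightarrow> 'm \<Rightarrow> 'm) \<Rightarrow> 'm \<Rightarrow>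
     'o species \<Rightarrow> ('o assembly \<Rightarrow> 'o \<Rightarrow> 'o) \<Rightarrow> (label \<Rightarrow> 'o) \<Rightarrow> ('o assembly \<Rightarrow> 'm \<Rightarrow> 'm) \<Rightarrow>
     nat \<Rightarrow> nat \<Rightarrow> int" where
  "monop_C_mu M \<nu> \<ee> \<O> \<eta> e \<tau> n k =
     mu_card (monop_carrier M \<O> (segment n)) (monop_le M \<nu> \<O> \<eta> \<tau>) (monop_bot \<ee> e (segment n))
       (monop_level M \<O> k (segment n))"


section \<open>Generating series and Riordan arrays\<close>

definition egf :: "'s species \<Rightarrow> rat fps" where
  "egf F = Abs_fps (\<lambda>n. of_nat (card (structs F (segment n))) / fact n)"

definition riordan_pair :: "rat fps \<Rightarrow> rat fps \<Rightarrow> bool" where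
  "riordan_pair F G \<longleftrightarrow> fps_nth F 0 \<noteq> 0 \<and> fps_nth G 0 = 0 \<and> fps_nth G 1 \<noteq> 0"

definition is_riordan_array :: "(nat \<Rightarrow> nat \<Rightarrow> rat) \<Rightarrow> rat fps \<times> rat fps \<Rightarrow> bool" where
  "is_riordan_array A = (\<lambda>(F, G). riordan_pair F G \<and>
     (\<forall>n k. A n k = fact n * fps_nth (F * G ^ k * fps_const (1 / fact k)) n))"

definition riordan_inverse :: "rat fps \<times> rat fps \<Rightarrow> rat fps \<times> rat fps" where
  "riordan_inverse = (\<lambda>(F, G). (1 / (F oo fps_inv G), fps_inv G))"

end

theory Submission imports Defs begin

text \<open>
  For an element \<open>x\<close> of the poset with \<open>k\<close> blocks, cancellation makes \<open>z \<mapsto> \<rho>(x, z)\<close> a bijection,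
  preserving the number of blocks, from the poset on the blocks of \<open>x\<close> onto the up-set of \<open>x\<close>. Hence
  exactly \<open>C k j\<close> elements with \<open>j\<close> blocks lie above \<open>x\<close>. Writing \<open>C'\<close> for the array of Moebius
  cardinals and interchanging summations, \<open>\<Sum>k. C' n k * C k j\<close> is the sum of
  \<open>\<Sum>x \<le> y. \<mu>(0, x)\<close> over all \<open>y\<close> with \<open>j\<close> blocks, and only \<open>y = 0\<close> contributes: \<open>C'\<close> is a left
  inverse of \<open>C\<close>. Counting identifies \<open>C\<close> with the Riordan array of \<open>(M(x), O(x))\<close>, so the Riordan
  array of the inverse pair is a right inverse of \<open>C\<close> and therefore equal to \<open>C'\<close>.
\<close>


section \<open>Riordan arrays\<close>

text \<open>Fundamental theorem of Riordan arrays: if a column of \<open>B\<close> has exponential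
  generating series \<open>c\<close>, then \<open>A\<close> sends it to the column with series
  \<open>F * (c oo G)\<close>. The factor \<open>1 / fact k\<close> in \<open>A n k\<close> cancels
  the \<open>fact k\<close> in \<open>B k j\<close>, leaving the expansion of \<open>c oo G\<close>
  in powers of \<open>G\<close>.\<close>

lemma riordan_array_mult:
  assumes A: "is_riordan_array A (F, G)" and B: "is_riordan_array B (H, K)"
  shows "(\<Sum>k\<le>n. A n k * B k j) =
    fact n * fps_nth (F * ((H * K ^ j * fps_const (1 / fact j)) oo G)) n"
proof -
  define c where "c = H * K ^ j * fps_const (1 / fact j)"
  have G0: "fps_nth G 0 = 0"
    using A by (simp add: is_riordan_array_def riordan_pair_def)
  \<comment> \<open>As \<open>G\<close> has no constant term, \<open>G ^ k\<close> contributes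
    nothing in degree \<open>m\<close> once \<open>k > m\<close>. The bound \<open>n\<close>,
    uniform in \<open>m\<close>, is what allows the two sums to be interchanged.\<close>
  have comp: "fps_nth (c oo G) m = (\<Sum>k\<le>n. fps_nth c k * fps_nth (G ^ k) m)" if "m \<le> n" for m
    unfolding fps_compose_nth
    by (rule sum.mono_neutral_left) (use that startsby_zero_power_prefix[OF G0] in auto)
  have "(\<Sum>k\<le>n. A n k * B k j) = (\<Sum>k\<le>n. fact n * (fps_nth (F * G ^ k) n * fps_nth c k))"
    using A B unfolding is_riordan_array_def c_def by (intro sum.cong) auto
  also have "\<dots> = fact n * (\<Sum>k\<le>n. \<Sum>i=0..n. fps_nth F i * (fps_nth c k * fps_nth (G ^ k) (n - i)))"
    by (simp add: sum_distrib_left sum_distrib_right fps_mult_nth mult_ac)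
  also have "\<dots> = fact n * (\<Sum>i=0..n. \<Sum>k\<le>n. fps_nth F i * (fps_nth c k * fps_nth (G ^ k) (n - i)))"
    by (subst sum.swap) rule
  also have "\<dots> = fact n * (\<Sum>i=0..n. fps_nth F i * fps_nth (c oo G) (n - i))"
    by (simp add: comp sum_distrib_left)
  finally show ?thesis
    by (simp add: fps_mult_nth c_def)
qed

lemma riordan_pair_inverse:
  assumes "riordan_pair F G"
  shows "riordan_pair (1 / (F oo fps_inv G)) (fps_inv G)"
proof -
  have "fps_nth (fps_inv G) 1 \<noteq> 0"
    using assms by (simp add: riordan_pair_def fps_inv_def)
  moreover have "fps_nth (fps_inv G) 0 = 0"
    by (simp add: fps_inv_def)
  ultimately show ?thesis
    using assms by (simp add: riordan_pair_def fps_divide_unit)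
qed

text \<open>Substituting \<open>G\<close> turns \<open>1 / (F oo fps_inv G)\<close> into
  \<open>inverse F\<close> and \<open>fps_inv G ^ j\<close> into \<open>fps_X ^ j\<close>. By the
  product rule, column \<open>j\<close> of the product has the series of x^j / j!, a unit
  column.\<close>

lemma riordan_array_mult_inverse:
  assumes A: "is_riordan_array A (F, G)" and B: "is_riordan_array B (riordan_inverse (F, G))"
  shows "(\<Sum>k\<le>n. A n k * B k j) = (if n = j then 1 else 0)"
proof -
  have F0: "fps_nth F 0 \<noteq> 0" and G0: "fps_nth G 0 = 0" and G1: "fps_nth G 1 \<noteq> 0"
    using A by (simp_all add: is_riordan_array_def riordan_pair_def)
  have I0: "fps_nth (fps_inv G) 0 = 0"
    by (simp add: fps_inv_def)
  have "F oo fps_inv G oo G = F"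
    using fps_compose_assoc[OF G0 I0, of F] by (simp add: fps_inv G0 G1[simplified])
  then have "1 / (F oo fps_inv G) oo G = inverse F"
    using F0 by (simp add: fps_divide_unit fps_inverse_compose[OF G0])
  then have "F * ((1 / (F oo fps_inv G) * fps_inv G ^ j * fps_const (1 / fact j)) oo G) =
      F * inverse F * fps_X ^ j * fps_const (1 / fact j)"
    using fps_inv[OF G0 G1]
    by (simp add: fps_compose_mult_distrib[OF G0] fps_compose_power[OF G0, symmetric] mult.assoc)
  moreover have "F * inverse F = 1"
    using inverse_mult_eq_1[OF F0] by (simp add: mult.commute)
  ultimately show ?thesis
    using riordan_array_mult[OF A B[unfolded riordan_inverse_def prod.case], of n j]
    by (simp add: fps_X_power_nth)
qed


section \<open>Counting structures by exponential generating series\<close>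

text \<open>The count is imposed on every finite label set, since complements and sets of blocks
  occur as ground sets besides segments. It makes the cardinality of \<open>S V\<close> a function
  of \<open>card V\<close> alone.\<close>

definition counted_by :: "(label set \<Rightarrow> 'a set) \<Rightarrow> rat fps \<Rightarrow> bool" where
  "counted_by S F \<longleftrightarrow> (\<forall>V. finite V \<longrightarrow>
     finite (S V) \<and> of_nat (card (S V)) = fact (card V) * fps_nth F (card V))"

lemma counted_byD:
  assumes "counted_by S F" "finite V"
  shows "finite (S V)" "of_nat (card (S V)) = fact (card V) * fps_nth F (card V)"
  using assms by (auto simp: counted_by_def)

lemma sum_Pow_card:
  fixes f :: "nat \<Rightarrow> 'a::comm_semiring_1"
  assumes "finite V"
  shows "(\<Sum>B\<in>Pow V. f (card B)) = (\<Sum>i\<le>card V. of_nat (card V choose i) * f i)"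
proof -
  have "(\<Sum>B\<in>Pow V. f (card B)) = (\<Sum>i\<le>card V. \<Sum>B\<in>{B \<in> Pow V. card B = i}. f (card B))"
    by (rule sum.group[symmetric]) (use assms in \<open>auto simp: card_mono\<close>)
  also have "\<dots> = (\<Sum>i\<le>card V. \<Sum>B\<in>{B. B \<subseteq> V \<and> card B = i}. f i)"
    by (intro sum.cong) auto
  also have "\<dots> = (\<Sum>i\<le>card V. of_nat (card V choose i) * f i)"
    using assms by (simp add: n_subsets)
  finally show ?thesis .
qed

text \<open>Grouping the subsets \<open>B\<close> by size gives a binomial convolution of the two
  counting sequences, which is the product of exponential generating series.\<close>

lemma counted_by_product:
  assumes S: "counted_by S F" and T: "counted_by T G"
  shows "counted_by (\<lambda>V. SIGMA B:Pow V. S B \<times> T (V - B)) (F * G)"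
  unfolding counted_by_def
proof (intro allI impI conjI)
  fix V :: "label set" assume V: "finite V"
  have fin: "finite (S B)" "finite (T (V - B))" if "B \<subseteq> V" for B
    using S T finite_subset[OF that V] V by (auto simp: counted_by_def)
  then show "finite (SIGMA B:Pow V. S B \<times> T (V - B))"
    using V by auto
  let ?n = "card V"
  let ?f = "\<lambda>i. fact i * fps_nth F i * (fact (?n - i) * fps_nth G (?n - i))"
  have "of_nat (card (SIGMA B:Pow V. S B \<times> T (V - B))) =
      (\<Sum>B\<in>Pow V. of_nat (card (S B)) * of_nat (card (T (V - B))) :: rat)"
    using V fin by (subst card_SigmaI) (auto simp: card_cartesian_product)
  also have "\<dots> = (\<Sum>B\<in>Pow V. ?f (card B))"
  proof (rule sum.cong)
    fix B assume "B \<in> Pow V"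
    then have "finite B" "finite (V - B)" "card (V - B) = ?n - card B"
      using V by (auto simp: card_Diff_subset finite_subset)
    then show "of_nat (card (S B)) * of_nat (card (T (V - B))) = ?f (card B)"
      using S T by (simp add: counted_by_def)
  qed simp
  also have "\<dots> = (\<Sum>i\<le>?n. of_nat (?n choose i) * ?f i)"
    using V by (rule sum_Pow_card)
  also have "\<dots> = (\<Sum>i\<le>?n. fact ?n * (fps_nth F i * fps_nth G (?n - i)))"
    by (intro sum.cong) (auto simp: binomial_fact)
  also have "\<dots> = fact ?n * fps_nth (F * G) ?n"
    by (simp add: fps_mult_nth sum_distrib_left atMost_atLeast0)
  finally show "of_nat (card (SIGMA B:Pow V. S B \<times> T (V - B))) = fact ?n * fps_nth (F * G) ?n" .
qed

section \<open>Functoriality: counts of structures depend only on the size of the ground set\<close>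

lemma is_speciesD:
  assumes "is_species F" "finite V"
  shows "finite (structs F V)"
    and "inj_on \<sigma> V \<Longrightarrow> s \<in> structs F V \<Longrightarrow> transport F \<sigma> V s \<in> structs F (\<sigma> ` V)"
    and "inj_on \<sigma> V \<Longrightarrow> (\<And>v. v \<in> V \<Longrightarrow> \<sigma> v = \<sigma>' v) \<Longrightarrow> s \<in> structs F V \<Longrightarrow>
      transport F \<sigma> V s = transport F \<sigma>' V s"
    and "s \<in> structs F V \<Longrightarrow> transport F id V s = s"
    and "inj_on \<sigma> V \<Longrightarrow> inj_on \<sigma>' (\<sigma> ` V) \<Longrightarrow> s \<in> structs F V \<Longrightarrow>
      transport F \<sigma>' (\<sigma> ` V) (transport F \<sigma> V s) = transport F (\<sigma>' \<circ> \<sigma>) V s"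
proof -
  note F = assms(1)[unfolded is_species_def]
  show "finite (structs F V)"
    by (rule F[THEN conjunct1, rule_format, OF assms(2)])
  show "inj_on \<sigma> V \<Longrightarrow> s \<in> structs F V \<Longrightarrow> transport F \<sigma> V s \<in> structs F (\<sigma> ` V)"
    by (rule F[THEN conjunct2, THEN conjunct1, rule_format, OF assms(2)])
  show "inj_on \<sigma> V \<Longrightarrow> (\<And>v. v \<in> V \<Longrightarrow> \<sigma> v = \<sigma>' v) \<Longrightarrow> s \<in> structs F V \<Longrightarrow>
      transport F \<sigma> V s = transport F \<sigma>' V s"
    by (rule F[THEN conjunct2, THEN conjunct2, THEN conjunct1, rule_format, OF assms(2)])
  show "s \<in> structs F V \<Longrightarrow> transport F id V s = s"
    by (rule F[THEN conjunct2, THEN conjunct2, THEN conjunct2, THEN conjunct1, rule_format,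
          OF assms(2)])
  show "inj_on \<sigma> V \<Longrightarrow> inj_on \<sigma>' (\<sigma> ` V) \<Longrightarrow> s \<in> structs F V \<Longrightarrow>
      transport F \<sigma>' (\<sigma> ` V) (transport F \<sigma> V s) = transport F (\<sigma>' \<circ> \<sigma>) V s"
    by (rule F[THEN conjunct2, THEN conjunct2, THEN conjunct2, THEN conjunct2, rule_format,
          OF assms(2)])
qed

text \<open>The composite of \<open>\<sigma>\<close> with its inverse is the identity on
  \<open>V\<close> only, so after merging the two transports the congruence law for maps agreeing on
  \<open>V\<close> is applied before the identity law.\<close>

lemma transport_inverse:
  assumes F: "is_species F" and V: "finite V" "inj_on \<sigma> V" and s: "s \<in> structs F V"
  shows "transport F (inv_into V \<sigma>) (\<sigma> ` V) (transport F \<sigma> V s) = s"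
proof -
  let ?i = "inv_into V \<sigma>"
  have agree: "(?i \<circ> \<sigma>) v = id v" if "v \<in> V" for v
    using V that by simp
  then have inj: "inj_on (?i \<circ> \<sigma>) V"
    by (auto intro: inj_onI)
  have "transport F ?i (\<sigma> ` V) (transport F \<sigma> V s) = transport F (?i \<circ> \<sigma>) V s"
    using is_speciesD(5)[OF F V _ s] by (simp add: inj_on_inv_into)
  also have "\<dots> = transport F id V s"
    using is_speciesD(3)[OF F V(1) inj agree s] .
  also have "\<dots> = s"
    using is_speciesD(4)[OF F V(1) s] .
  finally show ?thesis .
qed

lemma card_structs_le:
  assumes F: "is_species F" and V: "finite V" "inj_on \<sigma> V"
  shows "card (structs F V) \<le> card (structs F (\<sigma> ` V))"
proof (rule card_inj_on_le)
  show "inj_on (transport F \<sigma> V) (structs F V)"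
    using transport_inverse[OF F V] by (rule inj_on_inverseI)
  show "transport F \<sigma> V ` structs F V \<subseteq> structs F (\<sigma> ` V)"
    using is_speciesD(2)[OF F V(1) V(2)] by blast
  show "finite (structs F (\<sigma> ` V))"
    using F V by (simp add: is_speciesD(1))
qed

text \<open>Transport is injective, so a bijection in each direction yields both
  inequalities.\<close>

lemma card_structs_eq:
  assumes F: "is_species F" and VW: "finite V" "finite W" "card V = card W"
  shows "card (structs F V) = card (structs F W)"
proof -
  obtain \<sigma> where \<sigma>: "bij_betw \<sigma> V W"
    using VW finite_same_card_bij by blast
  obtain \<sigma>' where \<sigma>': "bij_betw \<sigma>' W V"
    using VW finite_same_card_bij by metis
  have "card (structs F V) \<le> card (structs F W)"
    using card_structs_le[OF F VW(1), of \<sigma>] \<sigma> by (simp add: bij_betw_def)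
  moreover have "card (structs F W) \<le> card (structs F V)"
    using card_structs_le[OF F VW(2), of \<sigma>'] \<sigma>' by (simp add: bij_betw_def)
  ultimately show ?thesis by simp
qed

lemma finite_segment [simp]: "finite (segment n)"
  by (simp add: segment_def)

lemma card_segment [simp]: "card (segment n) = n"
  by (simp add: segment_def card_image inj_on_def)

lemma counted_by_egf: "is_species F \<Longrightarrow> counted_by (structs F) (egf F)"
  unfolding counted_by_def
proof (intro allI impI conjI)
  fix V :: "label set" assume F: "is_species F" and V: "finite V"
  show "finite (structs F V)"
    using F V by (rule is_speciesD(1))
  show "of_nat (card (structs F V)) = fact (card V) * fps_nth (egf F) (card V)"
    using card_structs_eq[OF F V, of "segment (card V)"] by (simp add: egf_def)
qed

section \<open>Assemblies and their enumeration\<close>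

lemma assembliesD:
  assumes "a \<in> assemblies P V"
  shows "inj_on fst a" "partition_on V (fst ` a)" "\<And>B p. (B, p) \<in> a \<Longrightarrow> p \<in> structs P B"
    "\<And>B p. (B, p) \<in> a \<Longrightarrow> B \<subseteq> V" "\<And>B p. (B, p) \<in> a \<Longrightarrow> B \<noteq> {}"
proof -
  show "inj_on fst a" "partition_on V (fst ` a)" "\<And>B p. (B, p) \<in> a \<Longrightarrow> p \<in> structs P B"
    using assms by (auto simp: assemblies_def)
  then show "\<And>B p. (B, p) \<in> a \<Longrightarrow> B \<subseteq> V" "\<And>B p. (B, p) \<in> a \<Longrightarrow> B \<noteq> {}"
    by (auto simp: partition_on_def image_iff)
qed

lemma assemblies_disjoint:
  assumes "a \<in> assemblies P V" "(B, p) \<in> a" "(C, q) \<in> a" "B \<inter> C \<noteq> {}"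
  shows "B = C" "p = q"
proof -
  show "B = C"
    using assembliesD(2)[OF assms(1)] assms(2-4) unfolding partition_on_def pairwise_def disjnt_def
    by force
  then show "p = q"
    using assembliesD(1)[OF assms(1)] assms(2,3) by (metis fst_conv inj_onD snd_conv)
qed

lemma finite_assembly:
  assumes "finite V" "a \<in> assemblies P V"
  shows "finite a"
  using finite_elements[OF assms(1) assembliesD(2)[OF assms(2)]] assembliesD(1)[OF assms(2)]
  by (rule finite_imageD)

lemma finite_assemblies:
  assumes P: "is_species P" and V: "finite V"
  shows "finite (assemblies P V)"
proof (rule finite_subset)
  show "assemblies P V \<subseteq> Pow (SIGMA B:Pow V. structs P B)"
    using assembliesD by fast
  show "finite (Pow (SIGMA B:Pow V. structs P B))"
    using V is_speciesD(1)[OF P finite_subset[OF _ V]]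
    by (intro finite_Pow_iff[THEN iffD2] finite_SigmaI) auto
qed

text \<open>With \<open>remove_assembly\<close>, this passes between an assembly with a
  distinguished member and a structure on \<open>B\<close> paired with an assembly on the complement
  of \<open>B\<close>.\<close>

lemma insert_assembly:
  assumes B: "B \<subseteq> V" "B \<noteq> {}" "p \<in> structs P B" and a: "a \<in> assemblies P (V - B)"
  shows "insert (B, p) a \<in> assemblies P V" "(B, p) \<notin> a"
proof -
  have nin: "B \<notin> fst ` a"
    using assembliesD(4)[OF a] B by fastforce
  then show "(B, p) \<notin> a"
    by force
  have "disjnt B (\<Union> (fst ` a))"
    using partition_onD1[OF assembliesD(2)[OF a]] by (metis Diff_disjoint disjnt_def)
  then have "partition_on V (insert B (fst ` a))"
    using B assembliesD(2)[OF a] by (simp add: partition_on_insert)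
  then show "insert (B, p) a \<in> assemblies P V"
    using assembliesD(1,3)[OF a] B nin unfolding assemblies_def by (auto simp: inj_on_insert)
qed

lemma remove_assembly:
  assumes a: "a \<in> assemblies P V" and Bp: "(B, p) \<in> a"
  shows "a - {(B, p)} \<in> assemblies P (V - B)"
proof -
  have eq: "fst ` a = insert B (fst ` (a - {(B, p)}))"
    using Bp by force
  have "disjnt B (\<Union> (fst ` (a - {(B, p)})))"
    using assemblies_disjoint[OF a Bp] unfolding disjnt_def by fastforce
  then have "partition_on (V - B) (fst ` (a - {(B, p)}))"
    using assembliesD(2)[OF a] eq by (simp add: partition_on_insert)
  then show ?thesis
    using assembliesD(1,3)[OF a] unfolding assemblies_def by (auto intro: inj_on_subset)
qed

text \<open>Induction on \<open>k\<close>: distinguishing one of the \<open>Suc k\<close> members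
  and detaching it identifies \<open>Suc k\<close> copies of the assemblies with
  \<open>Suc k\<close> members with the product of \<open>P\<close> and the assemblies with
  \<open>k\<close> members. Each step thus multiplies the series by
  \<open>egf P / Suc k\<close>.\<close>

lemma counted_by_assemblies:
  assumes P: "is_species P" "positive P"
  shows "counted_by (\<lambda>V. {a \<in> assemblies P V. card a = k}) (egf P ^ k * fps_const (1 / fact k))"
proof (induction k)
  case 0
  have "{a \<in> assemblies P V. card a = 0} = (if V = {} then {{}} else {})" if "finite V" for V
  proof -
    have "{a \<in> assemblies P V. card a = 0} = {a \<in> assemblies P V. a = {}}"
      using finite_assembly[OF that, of _ P] by (auto simp: card_eq_0_iff)
    moreover have "{} \<in> assemblies P V \<longleftrightarrow> V = {}"
      by (auto simp: assemblies_def partition_on_def)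
    ultimately show ?thesis
      by auto
  qed
  then show ?case
    by (auto simp: counted_by_def)
next
  case (Suc k)
  let ?g = "\<lambda>k V. {a \<in> assemblies P V. card a = k}"
  let ?H = "egf P * (egf P ^ k * fps_const (1 / fact k))"
  have prod: "counted_by (\<lambda>V. SIGMA B:Pow V. structs P B \<times> ?g k (V - B)) ?H"
    by (rule counted_by_product[OF counted_by_egf[OF P(1)] Suc])
  show ?case
    unfolding counted_by_def
  proof (intro allI impI conjI)
    fix V :: "label set" assume V: "finite V"
    show fin: "finite (?g (Suc k) V)"
      using finite_assemblies[OF P(1) V] by simp
    \<comment> \<open>Count the assemblies with a distinguished member in two ways.\<close>
    have "bij_betw (\<lambda>(B, p, a). (insert (B, p) a, (B, p)))
        (SIGMA B:Pow V. structs P B \<times> ?g k (V - B)) (SIGMA a:?g (Suc k) V. a)"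
    proof (rule bij_betw_byWitness[where f' = "\<lambda>(a, (B, p)). (B, p, a - {(B, p)})"])
      \<comment> \<open>Positivity of \<open>P\<close> ensures that the first factor of a product
        structure can serve as a block.\<close>
      have ne: "B \<noteq> {}" if "p \<in> structs P B" for B p
        using P(2) that by (auto simp: positive_def)
      have ins: "insert (B, p) a \<in> ?g (Suc k) V" "(B, p) \<notin> a"
        if "B \<subseteq> V" "p \<in> structs P B" "a \<in> ?g k (V - B)" for B p a
        using insert_assembly[of B V p P a] ne that finite_assembly[of "V - B" a P] V
        by auto
      show "\<forall>x\<in>SIGMA B:Pow V. structs P B \<times> ?g k (V - B).
          (\<lambda>(a, (B, p)). (B, p, a - {(B, p)})) ((\<lambda>(B, p, a). (insert (B, p) a, (B, p))) x) = x"
        using ins(2) by auto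
      show "\<forall>x\<in>SIGMA a:?g (Suc k) V. a.
          (\<lambda>(B, p, a). (insert (B, p) a, (B, p))) ((\<lambda>(a, (B, p)). (B, p, a - {(B, p)})) x) = x"
        by auto
      show "(\<lambda>(B, p, a). (insert (B, p) a, (B, p))) ` (SIGMA B:Pow V. structs P B \<times> ?g k (V - B))
          \<subseteq> (SIGMA a:?g (Suc k) V. a)"
        using ins(1) by auto
      show "(\<lambda>(a, (B, p)). (B, p, a - {(B, p)})) ` (SIGMA a:?g (Suc k) V. a)
          \<subseteq> (SIGMA B:Pow V. structs P B \<times> ?g k (V - B))"
        using remove_assembly[of _ P V] assembliesD(3,4)[of _ P V] finite_assembly[OF V]
        by (fastforce simp: card_Diff_singleton)
    qed
    then have "card (SIGMA B:Pow V. structs P B \<times> ?g k (V - B)) = card (SIGMA a:?g (Suc k) V. a)"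
      by (rule bij_betw_same_card)
    also have "\<dots> = (\<Sum>a\<in>?g (Suc k) V. card a)"
      using fin finite_assembly[OF V] by (subst card_SigmaI) auto
    also have "\<dots> = Suc k * card (?g (Suc k) V)"
      by simp
    finally have eq: "card (SIGMA B:Pow V. structs P B \<times> ?g k (V - B)) = Suc k * card (?g (Suc k) V)" .
    have "of_nat (Suc k) * of_nat (card (?g (Suc k) V)) = fact (card V) * fps_nth ?H (card V)"
      using counted_byD(2)[OF prod V] by (simp only: eq of_nat_mult)
    moreover have "fps_nth ?H (card V) = fps_nth (egf P ^ Suc k) (card V) / fact k"
      by (simp add: mult.assoc[symmetric])
    ultimately show "of_nat (card (?g (Suc k) V)) =
        fact (card V) * fps_nth (egf P ^ Suc k * fps_const (1 / fact (Suc k))) (card V)"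
      by (simp add: field_simps del: of_nat_Suc power_Suc)
  qed
qed

lemma mem_monop_carrier:
  "((V1, V2), (m, a)) \<in> monop_carrier M \<O> V \<longleftrightarrow>
     V1 \<union> V2 = V \<and> V1 \<inter> V2 = {} \<and> m \<in> structs M V1 \<and> a \<in> assemblies \<O> V2"
  by (auto simp: monop_carrier_def prod_species_def assembly_species_def)

text \<open>The second ground set is the complement of the first, so an element of the level is a
  product structure indexed by its first ground set.\<close>

lemma counted_by_monop_level:
  assumes "is_species M" "is_species \<O>" "positive \<O>"
  shows "counted_by (monop_level M \<O> k) (egf M * egf \<O> ^ k * fps_const (1 / fact k))"
proof -
  let ?S = "\<lambda>V. SIGMA B:Pow V. structs M B \<times> {a \<in> assemblies \<O> (V - B). card a = k}"
  have prod: "counted_by ?S (egf M * (egf \<O> ^ k * fps_const (1 / fact k)))"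
    using assms counted_by_product[OF counted_by_egf counted_by_assemblies] by blast
  have "bij_betw (\<lambda>(B, m, a). ((B, V - B), (m, a))) (?S V) (monop_level M \<O> k V)" for V
    by (rule bij_betw_byWitness[where f' = "\<lambda>((V1, V2), (m, a)). (V1, m, a)"])
      (auto simp: monop_level_def mem_monop_carrier,
        (metis Diff_cancel Int_commute Un_Diff Un_empty_left Diff_triv)+)
  then have "card (?S V) = card (monop_level M \<O> k V)" "finite (?S V) = finite (monop_level M \<O> k V)" for V
    by (blast dest: bij_betw_same_card bij_betw_finite)+
  then show ?thesis
    using prod by (simp add: counted_by_def mult.assoc)
qed


section \<open>Assemblies on the blocks of an assembly\<close>

text \<open>\<open>card V\<close> is the sum of the block sizes, each at least 1. Equality with the
  number of blocks leaves no room for a block of size above 1.\<close>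

lemma partition_card_le:
  assumes V: "finite V" and Q: "partition_on V Q"
  shows "card Q \<le> card V" and "card Q = card V \<Longrightarrow> Q = (\<lambda>v. {v}) ` V"
proof -
  have fin: "finite B" if "B \<in> Q" for B
    using that V partition_onD1[OF Q] by (blast intro: finite_subset)
  have finQ: "finite Q"
    using V Q by (rule finite_elements)
  have pos: "card B \<ge> 1" if "B \<in> Q" for B
    using fin[OF that] partition_onD3[OF Q] that by (metis One_nat_def Suc_leI card_gt_0_iff)
  have cardV: "card V = (\<Sum>B\<in>Q. card B)"
    using Q fin by (rule product_partition)
  show "card Q \<le> card V"
    unfolding cardV using sum_mono[of Q "\<lambda>_. 1" card] pos by simp
  assume eq: "card Q = card V"
  have "card B = 1" if "B \<in> Q" for B
  proof (rule ccontr)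
    assume "card B \<noteq> 1"
    then have "\<exists>B\<in>Q. 1 < card B"
      using pos[OF that] that by force
    then have "(\<Sum>B\<in>Q. 1) < (\<Sum>B\<in>Q. card B)"
      using finQ pos by (intro sum_strict_mono_ex1) auto
    then show False
      using eq cardV by simp
  qed
  then have single: "\<exists>v. B = {v}" if "B \<in> Q" for B
    using that by (meson card_1_singletonE)
  show "Q = (\<lambda>v. {v}) ` V"
    using single partition_onD1[OF Q] by fastforce
qed

lemma mem_blocks: "l \<in> blocks a \<longleftrightarrow> (\<exists>B p. (B, p) \<in> a \<and> l = blk B)"
  by (simp add: blocks_def image_iff Bex_def)

lemma blocks_subassembly:
  assumes "D \<subseteq> blocks a"
  shows "blocks (subassembly a D) = D"
proof (rule set_eqI)
  fix l
  have "\<exists>B p. (B, p) \<in> a \<and> l = blk B" if "l \<in> D"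
    using subsetD[OF assms that] by (simp add: mem_blocks)
  then show "l \<in> blocks (subassembly a D) \<longleftrightarrow> l \<in> D"
    by (auto simp: mem_blocks subassembly_def)
qed

lemma subassembly_blocks: "subassembly a (blocks a) = a"
  by (auto simp: subassembly_def mem_blocks)

context
  fixes P :: "'p species" and V :: "label set" and a :: "'p assembly"
  assumes V: "finite V" and a: "a \<in> assemblies P V"
begin

lemma finite_block: "(B, p) \<in> a \<Longrightarrow> finite B"
  using finite_subset[OF assembliesD(4)[OF a] V] .

lemma members_blocks: "members ` blocks a = fst ` a"
  unfolding blocks_def image_image by (rule image_cong) (auto simp: finite_block)

text \<open>\<open>blk\<close> is known to be injective on finite sets only; finiteness of the
  blocks is inherited from \<open>V\<close>, and distinct members of an assembly have distinct
  blocks.\<close>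

lemma inj_on_blk: "inj_on (\<lambda>(B, p). blk B) a"
proof (rule inj_onI)
  fix u v assume u: "u \<in> a" and v: "v \<in> a" and eq: "(\<lambda>(B, p). blk B) u = (\<lambda>(B, p). blk B) v"
  have "finite (fst u)" "finite (fst v)"
    using finite_block[of "fst u" "snd u"] finite_block[of "fst v" "snd v"] u v by simp_all
  then have "fst u = fst v"
    using eq by (simp add: case_prod_beta blk_inject)
  then show "u = v"
    by (rule inj_onD[OF assembliesD(1)[OF a] _ u v])
qed

lemma card_blocks: "card (blocks a) = card a"
  unfolding blocks_def using inj_on_blk by (rule card_image)

lemma finite_blocks: "finite (blocks a)"
  using finite_assembly[OF V a] by (simp add: blocks_def)

lemma members_nonempty: "l \<in> blocks a \<Longrightarrow> members l \<noteq> {}"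
  using finite_block assembliesD(5)[OF a] by (auto simp: mem_blocks)

lemma members_disjoint:
  assumes "l \<in> blocks a" "l' \<in> blocks a" "v \<in> members l" "v \<in> members l'"
  shows "l = l'"
proof -
  obtain B p C q where "(B, p) \<in> a" "(C, q) \<in> a" "l = blk B" "l' = blk C"
    using assms(1,2) unfolding mem_blocks by blast
  then show ?thesis
    using assms assemblies_disjoint(1)[OF a, of B p C q] finite_block by auto
qed

lemma flat_blocks: "flat (blocks a) = V"
  using partition_onD1[OF assembliesD(2)[OF a]] by (simp add: flat_def members_blocks)

lemma flat_subset: "D \<subseteq> blocks a \<Longrightarrow> flat D \<subseteq> V"
  using flat_blocks by (auto simp: flat_def)

text \<open>Each block has a point, and that point lies in no other block, so membership of a block
  in a set of blocks can be read off from the union.\<close>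

lemma flat_subset_imp_subset:
  assumes "D \<subseteq> blocks a" "D' \<subseteq> blocks a" "flat D \<subseteq> flat D'"
  shows "D \<subseteq> D'"
proof
  fix l assume l: "l \<in> D"
  then obtain v where v: "v \<in> members l"
    using members_nonempty assms(1) by blast
  then obtain l' where "l' \<in> D'" "v \<in> members l'"
    using assms(3) l by (auto simp: flat_def)
  then show "l \<in> D'"
    using members_disjoint[of l l' v] assms l v by auto
qed

lemma flat_inject:
  "D \<subseteq> blocks a \<Longrightarrow> D' \<subseteq> blocks a \<Longrightarrow> flat D = flat D' \<Longrightarrow> D = D'"
  using flat_subset_imp_subset by blast

lemma flat_disjoint:
  "D \<subseteq> blocks a \<Longrightarrow> D' \<subseteq> blocks a \<Longrightarrow> D \<inter> D' = {} \<Longrightarrow> flat D \<inter> flat D' = {}"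
  using members_disjoint by (fastforce simp: flat_def)

lemma flat_nonempty: "D \<subseteq> blocks a \<Longrightarrow> D \<noteq> {} \<Longrightarrow> flat D \<noteq> {}"
  using members_nonempty by (fastforce simp: flat_def)

lemma subassembly_in_assemblies:
  assumes D: "D \<subseteq> blocks a"
  shows "subassembly a D \<in> assemblies P (flat D)"
proof -
  have sub: "subassembly a D \<subseteq> a"
    by (auto simp: subassembly_def)
  have img: "fst ` subassembly a D = members ` D"
  proof
    show "fst ` subassembly a D \<subseteq> members ` D"
      using finite_block by (force simp: subassembly_def image_iff)
    show "members ` D \<subseteq> fst ` subassembly a D"
    proof
      fix B assume "B \<in> members ` D"
      then obtain l where l: "l \<in> D" "B = members l" by blast
      then obtain C p where "(C, p) \<in> a" "l = blk C"
        using subsetD[OF D l(1)] unfolding mem_blocks by blast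
      then have "(B, p) \<in> subassembly a D"
        using l finite_block by (auto simp: subassembly_def)
      then show "B \<in> fst ` subassembly a D" by force
    qed
  qed
  have "partition_on (flat D) (members ` D)"
  proof (rule partition_onI)
    show "\<Union> (members ` D) = flat D"
      by (simp add: flat_def)
    show "{} \<notin> members ` D"
      using D members_nonempty by (metis imageE subsetD)
    fix p q assume "p \<in> members ` D" "q \<in> members ` D" "p \<noteq> q"
    then obtain l l' where l: "l \<in> D" "l' \<in> D" "p = members l" "q = members l'" "l \<noteq> l'"
      by blast
    then show "disjnt p q"
      using members_disjoint[OF subsetD[OF D l(1)] subsetD[OF D l(2)]] by (auto simp: disjnt_iff)
  qed
  then show ?thesis
    using sub img inj_on_subset[OF assembliesD(1)[OF a] sub] assembliesD(3)[OF a]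
    by (auto simp: assemblies_def)
qed

text \<open>As many members as points forces singleton blocks, and a singleton carries just one
  structure. This will identify the bottom element by its rank.\<close>

lemma assembly_all_singletons:
  assumes "card a = card V" and e: "\<And>v. structs P {v} = {e v}"
  shows "a = unit_assembly e V"
proof -
  have "card (fst ` a) = card V"
    using assms(1) card_image[OF assembliesD(1)[OF a]] by simp
  then have img: "fst ` a = (\<lambda>v. {v}) ` V"
    by (rule partition_card_le(2)[OF V assembliesD(2)[OF a]])
  have snd: "p = e v" if "({v}, p) \<in> a" for v p
    using assembliesD(3)[OF a that] e by simp
  show ?thesis
  proof
    show "a \<subseteq> unit_assembly e V"
    proof
      fix x assume x: "x \<in> a"
      then have "fst x \<in> (\<lambda>v. {v}) ` V"
        using img by blast
      then obtain v where "v \<in> V" "fst x = {v}" by blast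
      then show "x \<in> unit_assembly e V"
        using snd[of v "snd x"] x by (cases x) (auto simp: unit_assembly_def)
    qed
    show "unit_assembly e V \<subseteq> a"
    proof
      fix x assume "x \<in> unit_assembly e V"
      then obtain v where v: "v \<in> V" "x = ({v}, e v)"
        by (auto simp: unit_assembly_def)
      then have "{v} \<in> fst ` a"
        using img by blast
      then obtain p where "({v}, p) \<in> a" by force
      then show "x \<in> a"
        using v snd by blast
    qed
  qed
qed

end

section \<open>The assembly of operad units\<close>

lemma unit_assembly_in_assemblies:
  assumes "\<And>v. e v \<in> structs P {v}"
  shows "unit_assembly e V \<in> assemblies P V"
proof -
  have "fst ` unit_assembly e V = (\<lambda>v. {v}) ` V"
    by (force simp: unit_assembly_def)
  then show ?thesis
    using assms partition_on_singletons[of V]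
    by (auto simp: assemblies_def unit_assembly_def inj_on_def)
qed

lemma card_unit_assembly: "card (unit_assembly e V) = card V"
  unfolding unit_assembly_def by (rule card_image) (auto simp: inj_on_def)

lemma blocks_unit_assembly: "blocks (unit_assembly e V) = singleton_blk ` V"
  by (force simp: unit_assembly_def blocks_def singleton_blk_def)

lemma inj_singleton_blk: "inj singleton_blk"
  by (auto simp: inj_def singleton_blk_def blk_inject)

lemma flat_singleton_blk: "flat (singleton_blk ` V) = V"
  by (auto simp: flat_def singleton_blk_def)

lemma subassembly_unit_assembly:
  "W \<subseteq> V \<Longrightarrow> subassembly (unit_assembly e V) (singleton_blk ` W) = unit_assembly e W"
  by (auto simp: subassembly_def unit_assembly_def singleton_blk_def blk_inject image_iff)


text \<open>Well-foundedness of the strict order comes from the rank instead of from transitivity.\<close>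

lemma moebius_sum_below:
  fixes r :: "'a \<Rightarrow> nat"
  assumes fin: "finite A" and le_refl: "\<And>x. x \<in> A \<Longrightarrow> le x x"
    and rank: "\<And>x y. x \<in> A \<Longrightarrow> y \<in> A \<Longrightarrow> le x y \<Longrightarrow> x \<noteq> y \<Longrightarrow> r y < r x"
    and z: "z \<in> A" and least: "\<And>x. x \<in> A \<Longrightarrow> le z x" and y: "y \<in> A"
  shows "(\<Sum>x | x \<in> A \<and> le x y. moebius A le z x) = (if y = z then 1 else 0)"
proof -
  let ?\<mu> = "moebius A le z"
  have "wf {(x, y). x \<in> A \<and> y \<in> A \<and> le x y \<and> x \<noteq> y}"
  proof (rule wf_subset[OF wf_measure])
    \<comment> \<open>The rank drops along the order, so the deficit against the rank of the least
      element grows. The bound \<open>r x \<le> r z\<close> keeps the truncated subtraction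
      strict.\<close>
    show "{(x, y). x \<in> A \<and> y \<in> A \<and> le x y \<and> x \<noteq> y} \<subseteq> measure (\<lambda>x. r z - r x)"
    proof clarsimp
      fix x y assume h: "x \<in> A" "y \<in> A" "le x y" "x \<noteq> y"
      then have "r y < r x" "r x \<le> r z"
        using rank[OF h] rank[OF z h(1) least[OF h(1)]] by (auto simp: le_less)
      then show "r z - r x < r z - r y"
        by simp
    qed
  qed
  note wfrec = wfrec[OF this]
  have rec: "?\<mu> y = (if y = z then 1
      else if le z y then - (\<Sum>x | x \<in> A \<and> le z x \<and> le x y \<and> x \<noteq> y. ?\<mu> x)
      else 0)"
    unfolding moebius_def by (subst wfrec) (auto simp: cut_apply y intro!: sum.cong)
  \<comment> \<open>Since \<open>z\<close> is least, the interval in the recursion is the whole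
    strict lower set of \<open>y\<close>.\<close>
  have below: "{x \<in> A. le z x \<and> le x y \<and> x \<noteq> y} = {x \<in> A. le x y \<and> x \<noteq> y}"
    using least by blast
  have "{x \<in> A. le x y} = insert y {x \<in> A. le x y \<and> x \<noteq> y}"
    using y le_refl[OF y] by blast
  then have split: "(\<Sum>x | x \<in> A \<and> le x y. ?\<mu> x) = ?\<mu> y + (\<Sum>x | x \<in> A \<and> le x y \<and> x \<noteq> y. ?\<mu> x)"
    using fin by simp
  show ?thesis
  proof (cases "y = z")
    case True
    \<comment> \<open>An element strictly below \<open>z\<close> would also lie strictly above it,
      so its rank would be both larger and smaller than that of \<open>z\<close>.\<close>
    have "\<not> le x y" if "x \<in> A" "x \<noteq> y" for x
      using rank[OF that(1) y _ that(2)] rank[OF z that(1) least[OF that(1)]] that(2) True by auto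
    then have "(\<Sum>x | x \<in> A \<and> le x y \<and> x \<noteq> y. ?\<mu> x) = 0"
      by (intro sum.neutral) blast
    then show ?thesis
      using split rec True by simp
  next
    case False
    then show ?thesis
      using split rec below least[OF y] by simp
  qed
qed


section \<open>The order of a c-monop\<close>

context c_monop
begin

section \<open>Closure of the operations and properties of \<open>eta_bar\<close>\<close>

lemma nu_closed:
  assumes "finite V1" "finite V2" "V1 \<inter> V2 = {}" "m1 \<in> structs M V1" "m2 \<in> structs M V2"
  shows "\<nu> V1 V2 m1 m2 \<in> structs M (V1 \<union> V2)"
proof -
  have "((V1, V2), (m1, m2)) \<in> structs (prod_species M M) (V1 \<union> V2)"
    using assms by (simp add: prod_species_def)
  then show ?thesis
    using nu_hom[unfolded species_hom_def, rule_format, of "V1 \<union> V2" "((V1, V2), (m1, m2))"] assms(1,2)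
    by simp
qed

lemma eta_closed:
  assumes "finite V" "a \<in> assemblies \<O> V" "w \<in> structs \<O> (blocks a)"
  shows "\<eta> a w \<in> structs \<O> V"
proof -
  have "(a, w) \<in> structs (comp_species \<O> \<O>) V"
    using assms by (simp add: comp_species_def)
  then show ?thesis
    using eta_hom assms(1) unfolding species_hom_def by fastforce
qed

lemma tau_closed:
  assumes "finite V" "a \<in> assemblies \<O> V" "m \<in> structs M (blocks a)"
  shows "\<tau> a m \<in> structs M V"
proof -
  have "(a, m) \<in> structs (comp_species M \<O>) V"
    using assms by (simp add: comp_species_def)
  then show ?thesis
    using tau_hom assms(1) unfolding species_hom_def by fastforce
qed

lemma structs_M_empty: "structs M {} = {\<ee>}"
  using card_M_empty unit_M by (auto simp: card_1_singleton_iff)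

lemma structs_O_singleton: "structs \<O> {v} = {e v}"
  using card_O_singleton[of v] unit_O[of v] by (auto simp: card_1_singleton_iff)

context
  fixes V :: "label set" and a :: "'b assembly"
  assumes V: "finite V" and a: "a \<in> assemblies \<O> V"
begin

text \<open>On sets of blocks \<open>flat\<close> is injective and preserves disjointness and
  nonemptiness, so it carries the partition underlying \<open>b\<close> to a partition of
  \<open>V\<close>.\<close>

lemma eta_bar_closed:
  assumes b: "b \<in> assemblies \<O> (blocks a)"
  shows "eta_bar \<eta> a b \<in> assemblies \<O> V"
proof -
  have sub: "D \<subseteq> blocks a" if "(D, w) \<in> b" for D w
    using assembliesD(4)[OF b that] .
  have img: "fst ` eta_bar \<eta> a b = flat ` fst ` b"
    by (force simp: eta_bar_def)
  have inj_flat: "inj_on flat (fst ` b)"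
  proof (rule inj_onI)
    fix D D' assume "D \<in> fst ` b" "D' \<in> fst ` b" "flat D = flat D'"
    then show "D = D'"
      using flat_inject[OF V a] sub by (metis imageE prod.collapse)
  qed
  have "inj_on fst (eta_bar \<eta> a b)"
    using inj_flat assembliesD(1)[OF b] unfolding eta_bar_def inj_on_def by fastforce
  moreover have "partition_on V (flat ` fst ` b)"
  proof (rule partition_onI)
    have "\<Union> (flat ` fst ` b) = flat (\<Union> (fst ` b))"
      by (auto simp: flat_def)
    then show "\<Union> (flat ` fst ` b) = V"
      using partition_onD1[OF assembliesD(2)[OF b]] flat_blocks[OF V a] by simp
    fix p q assume "p \<in> flat ` fst ` b" "q \<in> flat ` fst ` b" "p \<noteq> q"
    then obtain D w D' w' where D: "(D, w) \<in> b" "(D', w') \<in> b" "p = flat D" "q = flat D'" "D \<noteq> D'"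
      by force
    then have "D \<inter> D' = {}"
      using assemblies_disjoint(1)[OF b] by blast
    then show "disjnt p q"
      using D flat_disjoint[OF V a sub sub] by (auto simp: disjnt_def)
  next
    show "{} \<notin> flat ` fst ` b"
      using flat_nonempty[OF V a sub] assembliesD(5)[OF b] by fastforce
  qed
  moreover have "\<eta> (subassembly a D) w \<in> structs \<O> (flat D)" if "(D, w) \<in> b" for D w
    using eta_closed[OF finite_subset[OF flat_subset[OF V a sub[OF that]] V]
        subassembly_in_assemblies[OF V a sub[OF that]]]
      assembliesD(3)[OF b that] blocks_subassembly[OF sub[OF that]] by simp
  ultimately show ?thesis
    using img by (auto simp: assemblies_def eta_bar_def)
qed

text \<open>The union determines \<open>D\<close>; cancellation for \<open>\<eta>\<close> over the
  subassembly on \<open>D\<close> then determines \<open>w\<close>. Stated for two assemblies, it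
  gives injectivity of \<open>eta_bar\<close> and, with \<open>b' = b\<close>, preservation of the
  number of members.\<close>

lemma eta_bar_member_inject:
  assumes b: "b \<in> assemblies \<O> (blocks a)" and b': "b' \<in> assemblies \<O> (blocks a)"
    and D: "(D, w) \<in> b" and D': "(D', w') \<in> b'"
    and eq: "flat D = flat D'" "\<eta> (subassembly a D) w = \<eta> (subassembly a D') w'"
  shows "(D, w) = (D', w')"
proof -
  have sub: "D \<subseteq> blocks a"
    using assembliesD(4)[OF b D] .
  have DD: "D = D'"
    using flat_inject[OF V a sub assembliesD(4)[OF b' D'] eq(1)] .
  have "w = w'"
  proof (rule eta_cancel)
    show "finite (flat D)"
      using flat_subset[OF V a sub] V by (rule finite_subset)
    show "subassembly a D \<in> assemblies \<O> (flat D)"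
      using subassembly_in_assemblies[OF V a sub] .
    show "w \<in> structs \<O> (blocks (subassembly a D))" "w' \<in> structs \<O> (blocks (subassembly a D))"
      using assembliesD(3)[OF b D] assembliesD(3)[OF b' D'] DD blocks_subassembly[OF sub]
      by simp_all
    show "\<eta> (subassembly a D) w = \<eta> (subassembly a D) w'"
      using eq(2) DD by simp
  qed
  then show ?thesis using DD by simp
qed

lemma eta_bar_inject:
  assumes b: "b \<in> assemblies \<O> (blocks a)" and b': "b' \<in> assemblies \<O> (blocks a)"
    and eq: "eta_bar \<eta> a b = eta_bar \<eta> a b'"
  shows "b = b'"
proof -
  have "c \<subseteq> c'" if c: "c \<in> assemblies \<O> (blocks a)" "c' \<in> assemblies \<O> (blocks a)"
    and cc: "eta_bar \<eta> a c = eta_bar \<eta> a c'" for c c'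
  proof (rule subrelI)
    fix D w assume D: "(D, w) \<in> c"
    then have "(flat D, \<eta> (subassembly a D) w) \<in> eta_bar \<eta> a c"
      unfolding eta_bar_def by (rule image_eqI[rotated]) simp
    then have "(flat D, \<eta> (subassembly a D) w) \<in> eta_bar \<eta> a c'"
      unfolding cc .
    then obtain D' w' where "(D', w') \<in> c'" "flat D = flat D'"
      "\<eta> (subassembly a D) w = \<eta> (subassembly a D') w'"
      by (auto simp: eta_bar_def)
    then show "(D, w) \<in> c'"
      using eta_bar_member_inject[OF c D] by metis
  qed
  from this[OF b b' eq] this[OF b' b eq[symmetric]] show ?thesis by blast
qed

lemma card_eta_bar:
  assumes b: "b \<in> assemblies \<O> (blocks a)"
  shows "card (eta_bar \<eta> a b) = card b"
  unfolding eta_bar_def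
proof (rule card_image, rule inj_onI)
  fix x y assume "x \<in> b" "y \<in> b"
    "(\<lambda>(D, w). (flat D, \<eta> (subassembly a D) w)) x = (\<lambda>(D, w). (flat D, \<eta> (subassembly a D) w)) y"
  then show "x = y"
    using eta_bar_member_inject[OF b b, of "fst x" "snd x" "fst y" "snd y"]
    by (auto simp: case_prod_beta)
qed

text \<open>The subassembly over a single block is one member of \<open>a\<close>, so the right unit
  law applies member by member.\<close>

lemma eta_bar_unit_right: "eta_bar \<eta> a (unit_assembly e (blocks a)) = a"
proof -
  have "(flat {blk B}, \<eta> (subassembly a {blk B}) (e (blk B))) = (B, p)" if Bp: "(B, p) \<in> a" for B p
  proof -
    have B: "finite B"
      using finite_block[OF V a Bp] .
    have "subassembly a {blk B} = {(B, p)}"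
      using Bp inj_on_blk[OF V a] by (fastforce simp: subassembly_def inj_on_def)
    then show ?thesis
      using B eta_unit_right[OF B assembliesD(3)[OF a Bp]] by (simp add: flat_def)
  qed
  then have "(\<lambda>(B, p). (flat {blk B}, \<eta> (subassembly a {blk B}) (e (blk B)))) ` a = (\<lambda>x. x) ` a"
    by (intro image_cong) auto
  then show ?thesis
    by (simp add: eta_bar_def unit_assembly_def blocks_def image_image case_prod_beta)
qed

text \<open>Reading each member of \<open>a\<close> on singletons lets the left unit law act member
  by member. The transported assembly later supplies the witness for \<open>bottom V\<close> lying
  below every element.\<close>

lemma eta_bar_unit_left:
  "assembly_transport \<O> singleton_blk a \<in> assemblies \<O> (singleton_blk ` V)"
  "eta_bar \<eta> (unit_assembly e V) (assembly_transport \<O> singleton_blk a) = a"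
proof -
  let ?f = "\<lambda>(B, p). (singleton_blk ` B, transport \<O> singleton_blk B p)"
  have inj: "inj_on singleton_blk B" for B
    using inj_singleton_blk by (rule inj_on_subset) simp
  have img: "fst ` assembly_transport \<O> singleton_blk a = (`) singleton_blk ` fst ` a"
    unfolding assembly_transport_def image_image by (rule image_cong) auto
  have "inj_on fst (assembly_transport \<O> singleton_blk a)"
  proof (rule inj_onI)
    fix u v assume "u \<in> assembly_transport \<O> singleton_blk a" "v \<in> assembly_transport \<O> singleton_blk a"
      and uv: "fst u = fst v"
    then obtain B p C q where B: "(B, p) \<in> a" "u = ?f (B, p)" and C: "(C, q) \<in> a" "v = ?f (C, q)"
      by (auto simp: assembly_transport_def)
    have "B = C"
      using uv B(2) C(2) inj_singleton_blk by (simp add: inj_image_eq_iff)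
    then have "p = q"
      using inj_onD[OF assembliesD(1)[OF a] _ B(1) C(1)] by simp
    then show "u = v"
      using \<open>B = C\<close> B(2) C(2) by simp
  qed
  moreover have "partition_on (singleton_blk ` V) ((`) singleton_blk ` fst ` a)"
  proof -
    have "{} \<notin> (`) singleton_blk ` fst ` a"
      using partition_onD3[OF assembliesD(2)[OF a]] by auto
    then show ?thesis
      using partition_on_inj_image[OF assembliesD(2)[OF a] inj] by simp
  qed
  moreover have "transport \<O> singleton_blk B p \<in> structs \<O> (singleton_blk ` B)" if "(B, p) \<in> a" for B p
    using is_speciesD(2)[OF species_O finite_block[OF V a that] inj assembliesD(3)[OF a that]] .
  ultimately show "assembly_transport \<O> singleton_blk a \<in> assemblies \<O> (singleton_blk ` V)"
    using img by (auto simp: assemblies_def assembly_transport_def)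
  have "(flat (singleton_blk ` B), \<eta> (subassembly (unit_assembly e V) (singleton_blk ` B))
      (transport \<O> singleton_blk B p)) = (B, p)" if Bp: "(B, p) \<in> a" for B p
    using eta_unit_left[OF finite_block[OF V a Bp] assembliesD(3)[OF a Bp]]
      subassembly_unit_assembly[OF assembliesD(4)[OF a Bp], of e] by (simp add: flat_singleton_blk)
  then have "(\<lambda>(B, p). (flat (singleton_blk ` B), \<eta> (subassembly (unit_assembly e V) (singleton_blk ` B))
      (transport \<O> singleton_blk B p))) ` a = (\<lambda>x. x) ` a"
    by (intro image_cong) auto
  then show "eta_bar \<eta> (unit_assembly e V) (assembly_transport \<O> singleton_blk a) = a"
    by (simp add: eta_bar_def assembly_transport_def image_image case_prod_beta)
qed

end

section \<open>Rank, bottom element and finiteness of the poset\<close>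

abbreviation "carrier \<equiv> monop_carrier M \<O>"
abbreviation "le \<equiv> monop_le M \<nu> \<O> \<eta> \<tau>"
abbreviation "bottom V \<equiv> monop_bot \<ee> e V"
abbreviation "rank x \<equiv> card (snd (snd x))"

lemma mem_level: "x \<in> monop_level M \<O> k V \<longleftrightarrow> x \<in> carrier V \<and> rank x = k"
  by (auto simp: monop_level_def)

lemma bot_carrier: "bottom V \<in> carrier V"
  using unit_M unit_O by (simp add: monop_bot_def mem_monop_carrier unit_assembly_in_assemblies)

lemma rank_bot: "rank (bottom V) = card V"
  by (simp add: monop_bot_def card_unit_assembly)

text \<open>Both sides are structures of \<open>M\<close> on the empty set, where there is only
  one.\<close>

lemma tau_empty: "\<tau> {} \<ee> = \<ee>"
  using tau_closed[of "{}" "{}" \<ee>] unit_M structs_M_empty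
  by (simp add: assemblies_def partition_on_empty blocks_def)

context
  fixes V :: "label set" and x :: "('a, 'b) pelem"
  assumes V: "finite V" and x: "x \<in> carrier V"
begin

lemma rank_le: "rank x \<le> card V"
proof -
  obtain V1 V2 m a where x_eq: "x = ((V1, V2), (m, a))"
    by (metis surj_pair)
  then have V2: "V2 \<subseteq> V" "finite V2" and a: "a \<in> assemblies \<O> V2"
    using x V by (auto simp: mem_monop_carrier)
  have "card a \<le> card V2"
    using partition_card_le(1)[OF V2(2) assembliesD(2)[OF a]] card_image[OF assembliesD(1)[OF a]]
    by simp
  then show ?thesis
    using x_eq card_mono[OF V V2(1)] by simp
qed

end

lemma carrier_eq_levels: "finite V \<Longrightarrow> carrier V = (\<Union>k\<le>card V. monop_level M \<O> k V)"
  using rank_le by (auto simp: mem_level)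

lemma finite_level: "finite V \<Longrightarrow> finite (monop_level M \<O> k V)"
  using counted_byD(1)[OF counted_by_monop_level[OF species_M species_O positive_O]] .

lemma finite_carrier: "finite V \<Longrightarrow> finite (carrier V)"
  by (simp add: carrier_eq_levels finite_level)

context
  fixes V :: "label set" and x :: "('a, 'b) pelem"
  assumes V: "finite V" and x: "x \<in> carrier V"
begin

lemma rank_eq_imp_bot:
  assumes "rank x = card V"
  shows "x = bottom V"
proof -
  obtain V1 V2 m a where x_eq: "x = ((V1, V2), (m, a))"
    by (metis surj_pair)
  then have V2: "V1 \<union> V2 = V" "V1 \<inter> V2 = {}" "finite V2" and m: "m \<in> structs M V1"
    and a: "a \<in> assemblies \<O> V2"
    using x V by (auto simp: mem_monop_carrier)
  have "card a \<le> card V2"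
    using partition_card_le(1)[OF V2(3) assembliesD(2)[OF a]] card_image[OF assembliesD(1)[OF a]]
    by simp
  \<comment> \<open>The chain \<open>card a \<le> card V2 \<le> card V\<close> collapses: the first
    equality will make all blocks singletons, the second empties \<open>V1\<close>.\<close>
  then have "V2 = V"
    using assms x_eq V V2 by (intro card_seteq) auto
  then have "V1 = {}" "a = unit_assembly e V"
    using V2 a assms x_eq assembly_all_singletons[OF V2(3) a _ structs_O_singleton] by auto
  then show ?thesis
    using m structs_M_empty x_eq \<open>V2 = V\<close> by (simp add: monop_bot_def)
qed

lemma finite_card_blocks: "finite (blocks (snd (snd x)))" "card (blocks (snd (snd x))) = rank x"
proof -
  obtain V1 V2 m a where x_eq: "x = ((V1, V2), (m, a))"
    by (metis surj_pair)
  then have "finite V2" "a \<in> assemblies \<O> V2"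
    using x V by (auto simp: mem_monop_carrier)
  then show "finite (blocks (snd (snd x)))" "card (blocks (snd (snd x))) = rank x"
    using x_eq finite_blocks card_blocks by auto
qed

end

section \<open>Composition with a fixed element and its up-set\<close>

context
  fixes V :: "label set" and x :: "('a, 'b) pelem"
  assumes V: "finite V" and x: "x \<in> carrier V"
begin

lemma rho_bar_bot: "rho_bar \<nu> \<eta> \<tau> x (bottom (blocks (snd (snd x)))) = x"
proof -
  obtain V1 V2 m a where x_eq: "x = ((V1, V2), (m, a))"
    by (metis surj_pair)
  then have V12: "finite V1" "finite V2" and m: "m \<in> structs M V1" and a: "a \<in> assemblies \<O> V2"
    using x V by (auto simp: mem_monop_carrier)
  have "subassembly a {} = {}" "flat {} = {}"
    by (auto simp: subassembly_def flat_def)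
  then show ?thesis
    using tau_empty nu_unit_right[OF V12(1) m] flat_blocks[OF V12(2) a] eta_bar_unit_right[OF V12(2) a]
    by (simp add: x_eq monop_bot_def subassembly_blocks)
qed

text \<open>The sets \<open>flat W1\<close> and \<open>flat W2\<close> split \<open>V2\<close>: the
  first is absorbed into the \<open>M\<close>-part, and on the second \<open>eta_bar\<close> keeps
  the number of members.\<close>

lemma rho_bar_closed:
  assumes z: "z \<in> carrier (blocks (snd (snd x)))"
  shows "rho_bar \<nu> \<eta> \<tau> x z \<in> carrier V" "rank (rho_bar \<nu> \<eta> \<tau> x z) = rank z"
proof -
  obtain V1 V2 m a where x_eq: "x = ((V1, V2), (m, a))"
    by (metis surj_pair)
  then have V12: "finite V1" "finite V2" "V1 \<union> V2 = V" "V1 \<inter> V2 = {}"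
    and m: "m \<in> structs M V1" and a: "a \<in> assemblies \<O> V2"
    using x V by (auto simp: mem_monop_carrier)
  obtain W1 W2 m' b where z_eq: "z = ((W1, W2), (m', b))"
    by (metis surj_pair)
  then have W12: "W1 \<union> W2 = blocks a" "W1 \<inter> W2 = {}"
    and m': "m' \<in> structs M W1" and b: "b \<in> assemblies \<O> W2"
    using z x_eq by (auto simp: mem_monop_carrier)
  then have sub: "W1 \<subseteq> blocks a" "W2 \<subseteq> blocks a" by auto
  have subV: "flat W1 \<subseteq> V2" "flat W2 \<subseteq> V2"
    using flat_subset[OF V12(2) a] sub by blast+
  have flats: "finite (flat W1)" "finite (flat W2)"
    using finite_subset[OF subV(1) V12(2)] finite_subset[OF subV(2) V12(2)] .
  have disj: "flat W1 \<inter> flat W2 = {}"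
    using flat_disjoint[OF V12(2) a sub W12(2)] .
  have "flat W1 \<union> flat W2 = flat (blocks a)"
    using W12(1) by (auto simp: flat_def)
  then have un: "flat W1 \<union> flat W2 = V2"
    using flat_blocks[OF V12(2) a] by simp
  note s1 = subassembly_in_assemblies[OF V12(2) a sub(1)] blocks_subassembly[OF sub(1)]
  note s2 = subassembly_in_assemblies[OF V12(2) a sub(2)] blocks_subassembly[OF sub(2)]
  have b': "b \<in> assemblies \<O> (blocks (subassembly a W2))"
    using b s2 by simp
  have "\<nu> V1 (flat W1) m (\<tau> (subassembly a W1) m') \<in> structs M (V1 \<union> flat W1)"
    using V12 subV flats m m' s1 tau_closed[OF flats(1) s1(1)] by (intro nu_closed) auto
  then show "rho_bar \<nu> \<eta> \<tau> x z \<in> carrier V"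
    using V12 subV disj un eta_bar_closed[OF flats(2) s2(1) b']
    by (auto simp: x_eq z_eq mem_monop_carrier)
  show "rank (rho_bar \<nu> \<eta> \<tau> x z) = rank z"
    using card_eta_bar[OF flats(2) s2(1) b'] by (simp add: x_eq z_eq)
qed

lemma rho_bar_inj: "inj_on (rho_bar \<nu> \<eta> \<tau> x) (carrier (blocks (snd (snd x))))"
proof (rule inj_onI)
  fix z z' assume z: "z \<in> carrier (blocks (snd (snd x)))" and z': "z' \<in> carrier (blocks (snd (snd x)))"
    and eq: "rho_bar \<nu> \<eta> \<tau> x z = rho_bar \<nu> \<eta> \<tau> x z'"
  obtain V1 V2 m a where x_eq: "x = ((V1, V2), (m, a))"
    by (metis surj_pair)
  then have V12: "finite V1" "finite V2" "V1 \<inter> V2 = {}"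
    and m: "m \<in> structs M V1" and a: "a \<in> assemblies \<O> V2"
    using x V by (auto simp: mem_monop_carrier)
  obtain W1 W2 k b where z_eq: "z = ((W1, W2), (k, b))"
    by (metis surj_pair)
  obtain W1' W2' k' b' where z'_eq: "z' = ((W1', W2'), (k', b'))"
    by (metis surj_pair)
  have W: "W1 \<union> W2 = blocks a" "W1 \<inter> W2 = {}" and k: "k \<in> structs M W1" and b: "b \<in> assemblies \<O> W2"
    using z x_eq z_eq by (auto simp: mem_monop_carrier)
  have W': "W1' \<union> W2' = blocks a" "W1' \<inter> W2' = {}"
    and k': "k' \<in> structs M W1'" and b': "b' \<in> assemblies \<O> W2'"
    using z' x_eq z'_eq by (auto simp: mem_monop_carrier)
  have sub: "W1 \<subseteq> blocks a" "W2 \<subseteq> blocks a" "W2' \<subseteq> blocks a"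
    using W W' by auto
  \<comment> \<open>The ground set of the resulting assembly reveals \<open>W2\<close>, and
    \<open>W1\<close> is its complement among the blocks. With these known, cancellation for
    \<open>\<nu>\<close>, then \<open>\<tau>\<close>, recovers the \<open>M\<close>-structure, and
    injectivity of \<open>eta_bar\<close> the assembly.\<close>
  have "flat W2 = flat W2'"
    using eq by (simp add: x_eq z_eq z'_eq)
  then have W2: "W2 = W2'"
    by (rule flat_inject[OF V12(2) a sub(2,3)])
  then have W1: "W1 = W1'"
    using W W' by blast
  have subV: "flat W1 \<subseteq> V2" "flat W2 \<subseteq> V2"
    using flat_subset[OF V12(2) a] sub by blast+
  have flats: "finite (flat W1)" "finite (flat W2)"
    using finite_subset[OF subV(1) V12(2)] finite_subset[OF subV(2) V12(2)] .
  note s1 = subassembly_in_assemblies[OF V12(2) a sub(1)] blocks_subassembly[OF sub(1)]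
  note s2 = subassembly_in_assemblies[OF V12(2) a sub(2)] blocks_subassembly[OF sub(2)]
  have "\<tau> (subassembly a W1) k = \<tau> (subassembly a W1) k'"
  proof (rule nu_cancel[OF V12(1) flats(1) _ m])
    show "V1 \<inter> flat W1 = {}"
      using subV V12 by blast
    show "\<tau> (subassembly a W1) k \<in> structs M (flat W1)" "\<tau> (subassembly a W1) k' \<in> structs M (flat W1)"
      using tau_closed[OF flats(1) s1(1)] s1(2) k k' W1 by auto
    show "\<nu> V1 (flat W1) m (\<tau> (subassembly a W1) k) = \<nu> V1 (flat W1) m (\<tau> (subassembly a W1) k')"
      using eq W1 by (simp add: x_eq z_eq z'_eq)
  qed
  then have "k = k'"
    using tau_cancel[OF flats(1) s1(1)] s1(2) k k' W1 by simp
  moreover have "b = b'"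
    using eta_bar_inject[OF flats(2) s2(1)] s2(2) b b' W2 eq by (simp add: x_eq z_eq z'_eq)
  ultimately show "z = z'"
    using W1 W2 by (simp add: z_eq z'_eq)
qed

lemma le_refl: "le x x"
  unfolding monop_le_def using rho_bar_bot[symmetric] bot_carrier by (rule bexI)

text \<open>If \<open>y\<close> differs from \<open>x\<close>, the element \<open>z\<close> composed
  with \<open>x\<close> is not the bottom over the blocks of \<open>x\<close>, and only the bottom
  has as many members as there are blocks.\<close>

lemma le_imp_rank_less:
  assumes "le x y" "x \<noteq> y"
  shows "rank y < rank x"
proof -
  let ?\<pi> = "blocks (snd (snd x))"
  obtain z where z: "z \<in> carrier ?\<pi>" "y = rho_bar \<nu> \<eta> \<tau> x z"
    using assms(1) by (auto simp: monop_le_def)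
  have "z \<noteq> bottom ?\<pi>"
    using z(2) assms(2) rho_bar_bot by auto
  then have "rank z \<noteq> rank x" "rank z \<le> rank x"
    using rank_eq_imp_bot[OF _ z(1)] rank_le[OF _ z(1)] finite_card_blocks[OF V x] by auto
  then show ?thesis
    using rho_bar_closed(2)[OF z(1)] z(2) by simp
qed

lemma bot_le: "le (bottom V) x"
proof -
  obtain V1 V2 m a where x_eq: "x = ((V1, V2), (m, a))"
    by (metis surj_pair)
  then have V12: "finite V1" "finite V2" "V1 \<union> V2 = V" "V1 \<inter> V2 = {}"
    and m: "m \<in> structs M V1" and a: "a \<in> assemblies \<O> V2"
    using x V by (auto simp: mem_monop_carrier)
  let ?s = "singleton_blk"
  \<comment> \<open>The witness is \<open>x\<close> itself, read on singletons; the unit laws of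
    \<open>\<tau>\<close>, \<open>\<nu>\<close> and \<open>\<eta>\<close> give \<open>x\<close>
    back.\<close>
  let ?z = "((?s ` V1, ?s ` V2), (transport M ?s V1 m, assembly_transport \<O> ?s a))"
  have inj: "inj_on ?s V1"
    using inj_singleton_blk by (rule inj_on_subset) simp
  have "?s ` V1 \<inter> ?s ` V2 = {}"
    using V12(4) inj_singleton_blk by (simp add: image_Int[symmetric])
  then have "?z \<in> carrier (blocks (snd (snd (bottom V))))"
    using V12(3) is_speciesD(2)[OF species_M V12(1) inj m] eta_bar_unit_left(1)[OF V12(2) a]
    by (auto simp: mem_monop_carrier monop_bot_def blocks_unit_assembly)
  moreover have "x = rho_bar \<nu> \<eta> \<tau> (bottom V) ?z"
  proof -
    have "subassembly (unit_assembly e V) (?s ` V1) = unit_assembly e V1"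
      "subassembly (unit_assembly e V) (?s ` V2) = unit_assembly e V2"
      using subassembly_unit_assembly[of V1 V e] subassembly_unit_assembly[of V2 V e] V12(3) by blast+
    then show ?thesis
      using tau_unit[OF V12(1) m] eta_bar_unit_left(2)[OF V12(2) a] nu_unit_left[OF V12(1) m]
      by (simp add: monop_bot_def flat_singleton_blk x_eq)
  qed
  ultimately show ?thesis
    unfolding monop_le_def by (rule bexI[rotated])
qed

lemma card_level_above:
  "card {y \<in> monop_level M \<O> j V. le x y} = card (monop_level M \<O> j (blocks (snd (snd x))))"
proof -
  have "{y \<in> monop_level M \<O> j V. le x y} =
      rho_bar \<nu> \<eta> \<tau> x ` monop_level M \<O> j (blocks (snd (snd x)))"
    using rho_bar_closed by (auto simp: mem_level monop_le_def)
  then show ?thesis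
    using rho_bar_inj by (simp add: card_image inj_on_subset mem_level subset_iff)
qed

end

text \<open>Read off from the generating series; it replaces the set of blocks of an element by a
  segment of the same size.\<close>

lemma card_level_cong:
  assumes "finite V" "finite W" "card V = card W"
  shows "card (monop_level M \<O> k V) = card (monop_level M \<O> k W)"
proof -
  have "(of_nat (card (monop_level M \<O> k V)) :: rat) = of_nat (card (monop_level M \<O> k W))"
    using counted_byD(2)[OF counted_by_monop_level[OF species_M species_O positive_O], of _ k] assms
    by simp
  then show ?thesis by simp
qed

section \<open>The arrays of counts and of Moebius cardinals\<close>

abbreviation "C_mu \<equiv> monop_C_mu M \<nu> \<ee> \<O> \<eta> e \<tau>"

lemma level_empty: "n < k \<Longrightarrow> monop_level M \<O> k (segment n) = {}"
  using rank_le[of "segment n"] by (metis mem_level card_segment ex_in_conv finite_segment not_le)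

lemma monop_C_eq_0: "n < k \<Longrightarrow> monop_C M \<O> n k = 0"
  by (simp add: monop_C_def level_empty)

lemma monop_C_mu_eq_0: "n < k \<Longrightarrow> C_mu n k = 0"
  by (simp add: monop_C_mu_def mu_card_def level_empty)

lemma C_mu_mult_C: "(\<Sum>k\<le>n. C_mu n k * int (monop_C M \<O> k j)) = (if n = j then 1 else 0)"
proof -
  let ?V = "segment n"
  let ?L = "monop_level M \<O> j ?V" and ?\<mu> = "moebius (carrier ?V) le (bottom ?V)"
  \<comment> \<open>An entry of the counting array becomes a sum over the level, so that the Moebius
    sum can be moved inside.\<close>
  have above: "int (monop_C M \<O> (rank x) j) = (\<Sum>y\<in>?L. if le x y then 1 else 0)" if x: "x \<in> carrier ?V" for x
  proof -
    have "monop_C M \<O> (rank x) j = card {y \<in> ?L. le x y}"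
      using card_level_above[OF _ x] finite_card_blocks[OF _ x]
        card_level_cong[of "segment (rank x)" "blocks (snd (snd x))" j]
      by (simp add: monop_C_def)
    then show ?thesis
      using finite_level[of ?V j] by (simp add: sum.If_cases Int_def)
  qed
  have "(\<Sum>k\<le>n. C_mu n k * int (monop_C M \<O> k j)) =
      (\<Sum>k\<le>n. \<Sum>x | x \<in> carrier ?V \<and> rank x = k. ?\<mu> x * int (monop_C M \<O> (rank x) j))"
  proof (rule sum.cong)
    fix k
    have "{x \<in> carrier ?V. rank x = k} = monop_level M \<O> k ?V"
      by (auto simp: mem_level)
    then show "C_mu n k * int (monop_C M \<O> k j) =
        (\<Sum>x | x \<in> carrier ?V \<and> rank x = k. ?\<mu> x * int (monop_C M \<O> (rank x) j))"
      by (simp add: monop_C_mu_def mu_card_def sum_distrib_right mem_level)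
  qed simp
  \<comment> \<open>Ranks are at most \<open>n\<close>, so the levels up to \<open>n\<close> exhaust
    the poset.\<close>
  also have "\<dots> = (\<Sum>x\<in>carrier ?V. ?\<mu> x * int (monop_C M \<O> (rank x) j))"
    using rank_le[of ?V] by (intro sum.group) (auto simp: finite_carrier)
  also have "\<dots> = (\<Sum>x\<in>carrier ?V. \<Sum>y\<in>?L. if le x y then ?\<mu> x else 0)"
    by (rule sum.cong) (simp_all add: above sum_distrib_left if_distrib cong: if_cong)
  also have "\<dots> = (\<Sum>y\<in>?L. \<Sum>x\<in>carrier ?V. if le x y then ?\<mu> x else 0)"
    by (rule sum.swap)
  also have "\<dots> = (\<Sum>y\<in>?L. if y = bottom ?V then 1 else 0)"
  proof (rule sum.cong)
    fix y assume "y \<in> ?L"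
    then have "y \<in> carrier ?V"
      by (simp add: mem_level)
    then show "(\<Sum>x\<in>carrier ?V. if le x y then ?\<mu> x else 0) = (if y = bottom ?V then 1 else 0)"
      using moebius_sum_below[of "carrier ?V" le rank "bottom ?V" y] finite_carrier[of ?V]
        le_refl[of ?V] le_imp_rank_less[of ?V] bot_carrier[of ?V] bot_le[of ?V]
      by (simp add: sum.inter_filter)
  qed simp
  \<comment> \<open>The bottom element has rank \<open>n\<close>, hence lies in level
    \<open>j\<close> only when \<open>j = n\<close>.\<close>
  also have "\<dots> = (if n = j then 1 else 0)"
    using bot_carrier[of ?V] rank_bot[of ?V] by (simp add: finite_level mem_level)
  finally show ?thesis .
qed

text \<open>The three conditions are the axioms on \<open>M\<close> over the empty set, on
  positivity of \<open>\<O>\<close>, and on \<open>\<O>\<close> over singletons.\<close>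

lemma riordan_pair_egf: "riordan_pair (egf M) (egf \<O>)"
proof -
  have "segment 1 = {Atom 1}" "segment 0 = {}"
    by (simp_all add: segment_def)
  then show ?thesis
    using card_M_empty card_O_singleton[of "Atom 1"] positive_O
    by (simp add: riordan_pair_def egf_def positive_def)
qed

lemma riordan_array_C: "is_riordan_array (\<lambda>n k. of_nat (monop_C M \<O> n k)) (egf M, egf \<O>)"
proof -
  have "of_nat (monop_C M \<O> n k) = fact n * fps_nth (egf M * egf \<O> ^ k * fps_const (1 / fact k)) n" for n k
    using counted_byD(2)[OF counted_by_monop_level[OF species_M species_O positive_O] finite_segment]
    unfolding monop_C_def card_segment .
  then show ?thesis
    using riordan_pair_egf by (simp add: is_riordan_array_def)
qed

end

text \<open>Evaluate \<open>L A R\<close> with both bracketings; triangularity keeps all sums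
  finite.\<close>

lemma triangular_left_inverse_eq_right_inverse:
  fixes L A R :: "nat \<Rightarrow> nat \<Rightarrow> 'a::comm_ring_1"
  assumes L: "\<And>n k. n < k \<Longrightarrow> L n k = 0" and A: "\<And>n k. n < k \<Longrightarrow> A n k = 0"
    and LA: "\<And>n j. (\<Sum>k\<le>n. L n k * A k j) = (if n = j then 1 else 0)"
    and AR: "\<And>n j. (\<Sum>k\<le>n. A n k * R k j) = (if n = j then 1 else 0)"
  shows "L = R"
proof (intro ext)
  fix n j
  have "R n j = (\<Sum>i\<le>n. if n = i then R i j else 0)"
    by simp
  also have "\<dots> = (\<Sum>i\<le>n. (if n = i then 1 else 0) * R i j)"
    by (intro sum.cong) auto
  also have "\<dots> = (\<Sum>i\<le>n. \<Sum>k\<le>n. L n k * (A k i * R i j))"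
    unfolding LA[symmetric] by (simp add: sum_distrib_right mult.assoc)
  also have "\<dots> = (\<Sum>k\<le>n. L n k * (\<Sum>i\<le>n. A k i * R i j))"
    by (subst sum.swap) (simp add: sum_distrib_left)
  also have "\<dots> = (\<Sum>k\<le>n. L n k * (if k = j then 1 else 0))"
  proof (rule sum.cong)
    fix k assume "k \<in> {..n}"
    \<comment> \<open>Row \<open>k\<close> of \<open>A\<close> vanishes beyond column
      \<open>k\<close>, which cuts the sum to the range in which \<open>AR\<close> is
      stated.\<close>
    then have "(\<Sum>i\<le>n. A k i * R i j) = (\<Sum>i\<le>k. A k i * R i j)"
      by (intro sum.mono_neutral_right) (auto simp: A)
    then show "L n k * (\<Sum>i\<le>n. A k i * R i j) = L n k * (if k = j then 1 else 0)"
      using AR by simp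
  qed simp
  also have "\<dots> = (\<Sum>k\<le>n. if k = j then L n k else 0)"
    by (intro sum.cong) auto
  \<comment> \<open>For \<open>j > n\<close> no index matches and the sum is 0, which agrees with
    \<open>L n j\<close> by triangularity.\<close>
  also have "\<dots> = L n j"
    using L[of n j] by simp
  finally show "L n j = R n j" ..
qed

theorem theorem7p2:
  fixes M :: "'m species" and \<nu> :: "label set \<Rightarrow> label set \<Rightarrow> 'm \<Rightarrow> 'm \<Rightarrow> 'm" and \<ee> :: 'm
    and \<O> :: "'o species" and \<eta> :: "'o assembly \<Rightarrow> 'o \<Rightarrow> 'o" and e :: "label \<Rightarrow> 'o"
    and \<tau> :: "'o assembly \<Rightarrow> 'm \<Rightarrow> 'm"
  assumes "c_monop M \<nu> \<ee> \<O> \<eta> e \<tau>"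
  shows "(\<forall>n k. n < k \<longrightarrow> monop_C M \<O> n k = 0 \<and> monop_C_mu M \<nu> \<ee> \<O> \<eta> e \<tau> n k = 0) \<and>
    (\<forall>n j. j \<le> n \<longrightarrow>
       (\<Sum>k=j..n. int (monop_C M \<O> n k) * monop_C_mu M \<nu> \<ee> \<O> \<eta> e \<tau> k j) = (if n = j then 1 else 0)) \<and>
    (\<forall>n j. j \<le> n \<longrightarrow>
       (\<Sum>k=j..n. monop_C_mu M \<nu> \<ee> \<O> \<eta> e \<tau> n k * int (monop_C M \<O> k j)) = (if n = j then 1 else 0)) \<and>
    is_riordan_array (\<lambda>n k. of_nat (monop_C M \<O> n k)) (egf M, egf \<O>) \<and>
    is_riordan_array (\<lambda>n k. of_int (monop_C_mu M \<nu> \<ee> \<O> \<eta> e \<tau> n k)) (riordan_inverse (egf M, egf \<O>))"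
proof -
  interpret c_monop M \<nu> \<ee> \<O> \<eta> e \<tau>
    by (rule assms)
  let ?C = "\<lambda>n k. of_nat (monop_C M \<O> n k) :: rat" and ?C' = "\<lambda>n k. of_int (C_mu n k) :: rat"
  \<comment> \<open>The Riordan array of the inverse pair, written out by coefficients. Its entries
    are rational, so it is compared with the Moebius array over \<open>rat\<close>.\<close>
  define R where "R = (\<lambda>n k. case riordan_inverse (egf M, egf \<O>) of (F, G) \<Rightarrow>
    fact n * fps_nth (F * G ^ k * fps_const (1 / fact k)) n)"
  have R: "is_riordan_array R (riordan_inverse (egf M, egf \<O>))"
    using riordan_pair_inverse[OF riordan_pair_egf]
    by (simp add: R_def is_riordan_array_def riordan_inverse_def)
  have CR: "(\<Sum>k\<le>n. ?C n k * R k j) = (if n = j then 1 else 0)" for n j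
    by (rule riordan_array_mult_inverse[OF riordan_array_C R])
  have "(\<Sum>k\<le>n. ?C' n k * ?C k j) = of_int (\<Sum>k\<le>n. C_mu n k * int (monop_C M \<O> k j))" for n j
    by simp
  then have C'C: "(\<Sum>k\<le>n. ?C' n k * ?C k j) = (if n = j then 1 else 0)" for n j
    unfolding C_mu_mult_C by simp
  have C'_eq: "?C' = R"
    by (rule triangular_left_inverse_eq_right_inverse[OF _ _ C'C CR])
      (simp_all add: monop_C_eq_0 monop_C_mu_eq_0)
  have restrict: "(\<Sum>k=j..n. f k) = (\<Sum>k\<le>n. f k)" if "\<And>k. k < j \<Longrightarrow> f k = 0" for f :: "nat \<Rightarrow> int" and j n
    using that by (intro sum.mono_neutral_left) auto
  have "(\<Sum>k=j..n. int (monop_C M \<O> n k) * C_mu k j) = (if n = j then 1 else 0)" for n j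
  proof -
    \<comment> \<open>Once \<open>?C'\<close> is identified with \<open>R\<close>, the right-inverse
      identity over \<open>rat\<close> descends to the integers by injectivity of
      \<open>of_int\<close>.\<close>
    have "of_int (\<Sum>k\<le>n. int (monop_C M \<O> n k) * C_mu k j) = (\<Sum>k\<le>n. ?C n k * ?C' k j)"
      by simp
    also have "\<dots> = of_int (if n = j then 1 else 0)"
      using CR[of n j] unfolding C'_eq[symmetric] by simp
    finally have "(\<Sum>k\<le>n. int (monop_C M \<O> n k) * C_mu k j) = (if n = j then 1 else 0)"
      by (simp only: of_int_eq_iff)
    then show ?thesis
      by (simp add: restrict monop_C_mu_eq_0)
  qed
  moreover have "(\<Sum>k=j..n. C_mu n k * int (monop_C M \<O> k j)) = (if n = j then 1 else 0)" for n j
    using C_mu_mult_C[of n j] by (simp add: restrict monop_C_eq_0)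
  ultimately show ?thesis
    using R riordan_array_C by (simp add: monop_C_eq_0 monop_C_mu_eq_0 C'_eq)
qed

end
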